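(* There is a universal constant $C$ such that the following holds. Let $\bar x_0\in X$ with $f'(\bar x_0)\ne0$. Suppose that there is $\mu^*>0$ with $f(x)-f^*\ge\frac{\mu^*}{2}\operatorname{dist}^2(x,X^* )$ for all $x\in\{z\in X:f(z)\le f(\bar x_0)\}$, and that $f$ is $(\rho,M_\rho)$-Hölder smooth on $X$ for some $\rho\in[0,1]$ and $M_\rho>0$, i.e. for all $x,y\in X$ and every $f'(x)\in\partial f(x)$, $$f(y)\le f(x)+\langle f'(x),y-x\rangle+\frac{M_\rho}{1+\rho}\|y-x\|^{1+\rho}.$$ Let $m\ge1$ be an integer, let $\mu_0\ge\mu^*$, and let $(\bar x_k,\mu_k,\Delta_k)_{k\ge0}$ be generated by A-BLW from $(\bar x_0,\mu_0,m)$. For any $\epsilon>0$ define $$S_\epsilon:=\max\left\{0,\left\lceil\log_{4/3}\left(\frac{4\mu_0\Delta_0}{\mu^*\epsilon}\right)\right\rceil\right\}\le\max\left\{0,\left\lceil\log_{4/3}\left(\frac{8\|f'(\bar x_0)\|^2}{\mu^*\epsilon}\right)\right\rceil\right\}.$$ Then $f(\bar x_{S_\epsilon})-f^*\le\epsilon$. The center sequence is Fejér monotone with respect to $X^*$: $$\operatorname{dist}(\bar x_k,X^* )\le\operatorname{dist}(\bar x_{k-1},X^* ),\qquad k\ge1.$$ Moreover, if $N_\epsilon$ denotes the total number of first-order oracle evaluations required to complete the $S_\epsilon$th outer iteration, then $$N_\epsilon\le C\min\left\{\frac{1}{1-\rho},S_\epsilon\right\}\left(\frac{M_\rho^2}{(\mu^*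 )^{1+\rho}\epsilon^{1-\rho}}\right)^{\frac{1}{1+3\rho}}+10S_\epsilon+2\log_2\left(\frac{4\mu_0}{\mu^*}\right)+1,$$ where at the endpoint $\rho=1$ the minimum is interpreted as $S_\epsilon$.
   Context: Setting. $X\subseteq\mathbb{R}^d$ is a closed convex set (Euclidean inner product $\langle\cdot,\cdot\rangle$ and norm $\|\cdot\|$), $f:X\to\mathbb{R}$ is closed convex, $f^*=\min_{x\in X}f(x)$, and $X^*=\arg\min_{x\in X}f(x)$ is assumed nonempty; $\operatorname{dist}$ is Euclidean distance. A first-order oracle queried at $y\in X$ returns $f(y)$ and a subgradient $f'(y)\in\partial f(y)$ (so $f(x)\ge f(y)+\langle f'(y),x-y\rangle$ for $x\in X$); $\ell_f(x;y):=f(y)+\langle f'(y),x-y\rangle$. Notation: $[t]_+=\max\{t,0\}$, $a\vee b=\max\{a,b\}$. An affine minorant of $f$ is an affine function $h$ with $h\le f$ on $X$. Procedure $\mathrm{A\text{-}BLCI}(\bar x,\mu,\Delta,m,a^{(0)})$. Inputs: $\bar x\in X$, $\mu>0$, $\Delta>0$, integer $m\ge1$, affine minorant $a^{(0)}$ of $f$. Output: a triple (affine minorant, point, flag True/False). Set $\ell=f(\bar x)-\Delta$. (1) If $\{x\in X:a^{(0)}(x)\le\ell\}=\emptyset$, return $(a^{(0)},\bar x,\text{True})$. (2) Let $x_0\in\arg\min_{x\in X}\{\|x-\bar x\|^2:a^{(0)}(x)\le\ell\}$ and set $\bar y_0=y_0=x_0$. (3) For $t=1,2,\dots$: (a) query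 the oracle at $y_{t-1}$; let $\psi_t(x):=a^{(t-1)}(x)\vee\max_{[t-m]_+\le i\le t-1}\ell_f(x;y_i)$ and $c_t:=\inf_{x\in X}\psi_t(x)$; if $c_t\ge\ell$, return (constant function $c_t$, $\bar x$, True). (b) Let $x_t$ be the minimizer of $\|x-\bar x\|^2$ over $x\in X$ subject to $a^{(t-1)}(x)\le\ell$ and $\ell_f(x;y_i)\le\ell$ for $[t-m]_+\le i\le t-1$. (c) Take optimal Lagrange (KKT) multipliers of these inequality constraints, normalize them to $\lambda_a,\lambda_i\ge0$ with $\lambda_a+\sum_i\lambda_i=1$, and set $a^{(t)}:=\lambda_aa^{(t-1)}+\sum_{i=[t-m]_+}^{t-1}\lambda_i\ell_f(\cdot;y_i)$. (d) If $\|x_t-\bar x\|^2/\Delta^2\ge2/(\mu\Delta)$, return $(a^{(t)},\bar x,\text{True})$. (e) With $\alpha_t=2/(t+1)$, set $\bar y_t=\alpha_tx_t+(1-\alpha_t)\bar y_{t-1}$ and $y_t=\alpha_{t+1}x_t+(1-\alpha_{t+1})\bar y_t$. (f) Query the oracle at $\bar y_t$; if $f(\bar y_t)<f(\bar x)-4\Delta/5$, return $(a^{(t)},\bar y_t,\text{False})$. Procedure A-BLW with inputs $(\bar x_0,\mu_0,m)$. Query the oracle at $\bar x_0$ and set $\Delta_0:=2\|f'(\bar x_0)\|^2/\mu_0$. For $k=1,2,\dots$ (outer iterations): set $\hat\mu_k:=\mu_{k-1}$, $\hat\Delta_k:=\frac34\Delta_{k-1}$. (i) Run $(a_{k,1},y_{k,1},\mathrm{flag})\leftarrow\mathrm{A\text{-}BLCI}(\bar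 x_{k-1},\hat\mu_k,\hat\Delta_k,m,\ell_f(\cdot;\bar x_{k-1}))$. If the flag is True, set $(\bar x_k,\mu_k,\Delta_k):=(\bar x_{k-1},\hat\mu_k,\hat\Delta_k)$ and go to outer iteration $k+1$. (ii) Otherwise run $(a_{k,2},z_k,\mathrm{flag})\leftarrow\mathrm{A\text{-}BLCI}(\bar x_{k-1},\hat\mu_k,4\hat\Delta_k/5,m,a_{k,1})$. If the flag is True, set $(\bar x_k,\mu_k,\Delta_k):=(\bar x_{k-1},\hat\mu_k,\hat\Delta_k)$ and go to $k+1$. (iii) Otherwise set $\bar x_k:=z_k$, $\mu_{k,0}:=\hat\mu_k$, $\Delta_{k,0}:=\hat\Delta_k$, $a^{[k]}_0:=\ell_f(\cdot;\bar x_k)$, and for $r=1,2,\dots$ run $(a^{[k]}_r,x_{k,r},\mathrm{flag})\leftarrow\mathrm{A\text{-}BLCI}(\bar x_k,\mu_{k,r-1},\Delta_{k,r-1},m,a^{[k]}_{r-1})$; if the flag is True, set $\mu_k:=\mu_{k,r-1}$, $\Delta_k:=\Delta_{k,r-1}$ and go to $k+1$; otherwise discard $x_{k,r}$, set $\mu_{k,r}:=\mu_{k,r-1}/2$, $\Delta_{k,r}:=2\Delta_{k,r-1}$ and continue with $r+1$. Oracle evaluations are counted at every "query" above. *)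

theory Defs
  imports "HOL-Analysis.Analysis"
begin

section \<open>All Euclidean spaces inside one type\<close>

text \<open>
  The constant of the theorem must not depend on the dimension. A statement about a type
  variable of class \<^class>\<open>euclidean_space\<close> would let an existentially quantified constant vary with
  the type, hence with the dimension. We therefore use the inner product space of finitely
  supported real sequences; \<open>Rn d\<close>, the sequences supported on the first \<open>d\<close> coordinates, is a
  closed subspace and is Euclidean \<open>d\<close>-space with its usual inner product, norm and topology.
\<close>

typedef fsvec = "{x :: nat \<Rightarrow> real. finite {i. x i \<noteq> 0}}"
  morphisms coord Abs_fsvec
  by (rule exI[of _ "\<lambda>_. 0"]) simp

setup_lifting type_definition_fsvec

lemma finite_coord [simp]: "finite {i. coord x i \<noteq> 0}"
  using coord by simp

instantiation fsvec :: real_inner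
begin

lift_definition zero_fsvec :: fsvec is "\<lambda>_. 0" by simp

lift_definition plus_fsvec :: "fsvec \<Rightarrow> fsvec \<Rightarrow> fsvec" is "\<lambda>x y i. x i + y i"
  by (erule (1) rev_finite_subset[OF finite_UnI]) auto

lift_definition uminus_fsvec :: "fsvec \<Rightarrow> fsvec" is "\<lambda>x i. - x i" by simp

lift_definition minus_fsvec :: "fsvec \<Rightarrow> fsvec \<Rightarrow> fsvec" is "\<lambda>x y i. x i - y i"
  by (erule (1) rev_finite_subset[OF finite_UnI]) auto

lift_definition scaleR_fsvec :: "real \<Rightarrow> fsvec \<Rightarrow> fsvec" is "\<lambda>r x i. r * x i"
  by (erule rev_finite_subset) auto

definition inner_fsvec :: "fsvec \<Rightarrow> fsvec \<Rightarrow> real"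
  where "inner_fsvec x y = (\<Sum>i\<in>{i. coord x i \<noteq> 0}. coord x i * coord y i)"

definition norm_fsvec :: "fsvec \<Rightarrow> real"
  where "norm_fsvec x = sqrt (inner x x)"

definition dist_fsvec :: "fsvec \<Rightarrow> fsvec \<Rightarrow> real"
  where "dist_fsvec x y = norm (x - y)"

definition sgn_fsvec :: "fsvec \<Rightarrow> fsvec"
  where "sgn_fsvec x = inverse (norm x) *\<^sub>R x"

definition uniformity_fsvec :: "(fsvec \<times> fsvec) filter"
  where "uniformity_fsvec = (INF e\<in>{0<..}. principal {(x, y). dist x y < e})"

definition open_fsvec :: "fsvec set \<Rightarrow> bool"
  where "open_fsvec U \<longleftrightarrow> (\<forall>x\<in>U. \<forall>\<^sub>F (x', y) in uniformity. x' = x \<longrightarrow> y \<in> U)"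

lemma inner_fsvec_superset:
  assumes "finite A" "{i. coord x i \<noteq> 0} \<subseteq> A"
  shows "inner x y = (\<Sum>i\<in>A. coord x i * coord y i)"
  unfolding inner_fsvec_def by (rule sum.mono_neutral_left) (use assms in auto)

instance
proof
  fix x y z :: fsvec and r s :: real
  show "x + y + z = x + (y + z)" by transfer (simp add: add.assoc)
  show "x + y = y + x" by transfer (simp add: add.commute)
  show "0 + x = x" by transfer simp
  show "- x + x = 0" by transfer simp
  show "x - y = x + - y" by transfer simp
  show "r *\<^sub>R (x + y) = r *\<^sub>R x + r *\<^sub>R y" by transfer (simp add: distrib_left)
  show "(r + s) *\<^sub>R x = r *\<^sub>R x + s *\<^sub>R x" by transfer (simp add: distrib_right)
  show "r *\<^sub>R s *\<^sub>R x = (r * s) *\<^sub>R x" by transfer (simp add: mult.assoc)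
  show "1 *\<^sub>R x = x" by transfer simp
  show "dist x y = norm (x - y)" by (rule dist_fsvec_def)
  show "sgn x = inverse (norm x) *\<^sub>R x" by (rule sgn_fsvec_def)
  show "(uniformity :: (fsvec \<times> fsvec) filter) = (INF e\<in>{0<..}. principal {(x, y). dist x y < e})"
    by (rule uniformity_fsvec_def)
  show "open U \<longleftrightarrow> (\<forall>x\<in>U. \<forall>\<^sub>F (x', y) in uniformity. x' = x \<longrightarrow> y \<in> U)" for U :: "fsvec set"
    by (rule open_fsvec_def)
  define A where "A = {i. coord x i \<noteq> 0} \<union> {i. coord y i \<noteq> 0} \<union> {i. coord z i \<noteq> 0}"
  have A: "finite A" unfolding A_def by simp
  have ix: "inner x v = (\<Sum>i\<in>A. coord x i * coord v i)"
    and iy: "inner y v = (\<Sum>i\<in>A. coord y i * coord v i)" for v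
    by (rule inner_fsvec_superset[OF A]; auto simp: A_def)+
  show "inner x y = inner y x" by (simp add: ix iy mult.commute)
  have "inner (x + y) z = (\<Sum>i\<in>A. coord (x + y) i * coord z i)"
    by (rule inner_fsvec_superset[OF A]) (auto simp: A_def plus_fsvec.rep_eq)
  then show "inner (x + y) z = inner x z + inner y z"
    by (simp add: ix iy plus_fsvec.rep_eq distrib_right sum.distrib)
  have "inner (r *\<^sub>R x) y = (\<Sum>i\<in>A. coord (r *\<^sub>R x) i * coord y i)"
    by (rule inner_fsvec_superset[OF A]) (auto simp: A_def scaleR_fsvec.rep_eq)
  then show "inner (r *\<^sub>R x) y = r * inner x y"
    by (simp add: ix scaleR_fsvec.rep_eq sum_distrib_left mult.assoc)
  show "0 \<le> inner x x" unfolding inner_fsvec_def by (rule sum_nonneg) simp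
  have "inner x x = 0 \<longleftrightarrow> (\<forall>i. coord x i = 0)"
    unfolding inner_fsvec_def by (subst sum_nonneg_eq_0_iff) auto
  also have "\<dots> \<longleftrightarrow> x = 0" by transfer auto
  finally show "inner x x = 0 \<longleftrightarrow> x = 0" .
  show "norm x = sqrt (inner x x)" by (rule norm_fsvec_def)
qed

end

definition Rn :: "nat \<Rightarrow> fsvec set"
  where "Rn d = {x. \<forall>i\<ge>d. coord x i = 0}"

lemma inner_Rn: "x \<in> Rn d \<Longrightarrow> inner x y = (\<Sum>i<d. coord x i * coord y i)"
  by (rule inner_fsvec_superset) (auto simp: Rn_def not_less[symmetric])


section \<open>The optimization problem\<close>

definition argmin_set :: "'a set \<Rightarrow> ('a \<Rightarrow> real) \<Rightarrow> 'a set"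
  where "argmin_set S h = {x\<in>S. \<forall>y\<in>S. h x \<le> h y}"

definition subdifferential :: "nat \<Rightarrow> fsvec set \<Rightarrow> (fsvec \<Rightarrow> real) \<Rightarrow> fsvec \<Rightarrow> fsvec set"
  where "subdifferential d X f y = {v \<in> Rn d. \<forall>x\<in>X. f x \<ge> f y + inner v (x - y)}"

text \<open>
  In the next definition \<open>D x\<close> is the set over which the subgradient \<open>f'(x)\<close> ranges. It is kept
  as a parameter because adding vectors normal to \<open>X\<close> to a subgradient relative to \<open>X\<close> yields
  another one: if \<open>D x\<close> has to consist of all subgradients relative to \<open>X\<close>, the inequality can
  only hold when \<open>X\<close> is an affine subspace. That case is \<open>D = subdifferential d X f\<close>; the
  subdifferential of an extension of \<open>f\<close> beyond \<open>X\<close> is another admissible choice.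
\<close>

definition holder_smooth_on ::
  "'a::real_inner set \<Rightarrow> ('a \<Rightarrow> real) \<Rightarrow> ('a \<Rightarrow> 'a set) \<Rightarrow> real \<Rightarrow> real \<Rightarrow> bool"
  where "holder_smooth_on X f D \<rho> M \<longleftrightarrow>
    (\<forall>x\<in>X. \<forall>y\<in>X. \<forall>v\<in>D x.
       f y \<le> f x + inner v (y - x) + M / (1 + \<rho>) * norm (y - x) powr (1 + \<rho>))"


section \<open>The procedure A-BLCI\<close>

text \<open>
  The pair \<open>(v, b)\<close> represents the affine function \<open>x \<mapsto> \<langle>v, x\<rangle> + b\<close>; linear combinations of
  affine functions are then linear combinations of pairs.
\<close>

type_synonym 'a affine = "'a \<times> real"

definition aff :: "'a::real_inner affine \<Rightarrow> 'a \<Rightarrow> real"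
  where "aff a x = inner (fst a) x + snd a"

definition lin :: "('a \<Rightarrow> real) \<Rightarrow> ('a \<Rightarrow> 'a) \<Rightarrow> 'a::real_inner \<Rightarrow> 'a affine"
  where "lin f g y = (g y, f y - inner (g y) y)"

lemma aff_lin: "aff (lin f g y) x = f y + inner (g y) (x - y)"
  by (simp add: aff_def lin_def inner_diff_right)

text \<open>
  KKT conditions at \<open>x\<close> for minimizing \<open>\<parallel>x - xbar\<parallel>\<^sup>2\<close> over \<open>X\<close> subject to \<open>aff a x \<le> l\<close> and
  \<open>aff (b i) x \<le> l\<close> for \<open>i \<in> W\<close>. The third line says that the negative gradient of the
  Lagrangian lies in the normal cone of \<open>X\<close> at \<open>x\<close>.
\<close>

definition kkt_multipliers ::
  "'a::real_inner set \<Rightarrow> 'a \<Rightarrow> real \<Rightarrow> 'a affine \<Rightarrow> nat set \<Rightarrow> (nat \<Rightarrow> 'a affine) \<Rightarrow>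
   'a \<Rightarrow> real \<Rightarrow> (nat \<Rightarrow> real) \<Rightarrow> bool"
  where "kkt_multipliers X xbar l a W b x \<eta>a \<eta> \<longleftrightarrow>
    x \<in> X \<and> aff a x \<le> l \<and> (\<forall>i\<in>W. aff (b i) x \<le> l) \<and>
    \<eta>a \<ge> 0 \<and> (\<forall>i\<in>W. \<eta> i \<ge> 0) \<and>
    (\<forall>z\<in>X. inner (- (2 *\<^sub>R (x - xbar) + \<eta>a *\<^sub>R fst a + (\<Sum>i\<in>W. \<eta> i *\<^sub>R fst (b i)))) (z - x) \<le> 0) \<and>
    \<eta>a * (aff a x - l) = 0 \<and> (\<forall>i\<in>W. \<eta> i * (aff (b i) x - l) = 0)"

text \<open>Truncated subtraction on \<^typ>\<open>nat\<close> is the positive part \<open>[t - m]\<^sub>+\<close>.\<close>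

definition window :: "nat \<Rightarrow> nat \<Rightarrow> nat set"
  where "window m t = {t - m..<t}"

text \<open>The argument \<open>ys\<close> is the list \<open>[y\<^sub>0, \<dots>, y\<^sub>t\<^sub>-\<^sub>1]\<close>, so \<open>t = length ys\<close>.\<close>

definition bundle_model ::
  "('a \<Rightarrow> real) \<Rightarrow> ('a \<Rightarrow> 'a) \<Rightarrow> nat \<Rightarrow> 'a::real_inner affine \<Rightarrow> 'a list \<Rightarrow> 'a \<Rightarrow> real"
  where "bundle_model f g m a ys x =
    max (aff a x) (Max ((\<lambda>i. aff (lin f g (ys ! i)) x) ` window m (length ys)))"

definition bundle_inf ::
  "'a set \<Rightarrow> ('a \<Rightarrow> real) \<Rightarrow> ('a \<Rightarrow> 'a) \<Rightarrow> nat \<Rightarrow> 'a::real_inner affine \<Rightarrow> 'a list \<Rightarrow> ereal"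
  where "bundle_inf X f g m a ys = (INF x\<in>X. ereal (bundle_model f g m a ys x))"

text \<open>
  Steps (b) and (c) of iteration \<open>t = length ys\<close>, with \<open>l\<close> the level: \<open>x\<close> is the projection
  \<open>x\<^sub>t\<close> and \<open>a'\<close> an aggregate \<open>a\<^sup>(\<^sup>t\<^sup>)\<close> obtained from \<open>a = a\<^sup>(\<^sup>t\<^sup>-\<^sup>1\<^sup>)\<close> by normalized multipliers.
  Multipliers need not be unique; every choice is allowed.
\<close>

definition project_aggregate ::
  "'a set \<Rightarrow> ('a \<Rightarrow> real) \<Rightarrow> ('a \<Rightarrow> 'a) \<Rightarrow> nat \<Rightarrow> 'a \<Rightarrow> real \<Rightarrow> 'a::real_inner affine \<Rightarrow> 'a list \<Rightarrow>
   'a \<Rightarrow> 'a affine \<Rightarrow> bool"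
  where "project_aggregate X f g m xbar l a ys x a' \<longleftrightarrow>
    (let W = window m (length ys); b = (\<lambda>i. lin f g (ys ! i)) in
     x \<in> argmin_set {z\<in>X. aff a z \<le> l \<and> (\<forall>i\<in>W. aff (b i) z \<le> l)} (\<lambda>z. (norm (z - xbar))\<^sup>2) \<and>
     (\<exists>\<eta>a \<eta> s. kkt_multipliers X xbar l a W b x \<eta>a \<eta> \<and> s = \<eta>a + (\<Sum>i\<in>W. \<eta> i) \<and> s > 0 \<and>
        a' = (\<eta>a / s) *\<^sub>R a + (\<Sum>i\<in>W. (\<eta> i / s) *\<^sub>R b i)))"

text \<open>
  States of a call: \<open>Entry a\<^sup>(\<^sup>0\<^sup>)\<close>; \<open>Loop a\<^sup>(\<^sup>t\<^sup>-\<^sup>1\<^sup>) ybar\<^sub>t\<^sub>-\<^sub>1 [y\<^sub>0, \<dots>, y\<^sub>t\<^sub>-\<^sub>1]\<close>, before iteration \<open>t\<close>;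
  and \<open>Return\<close> with the output triple.
\<close>

datatype 'a blci_state =
    Entry "'a affine"
  | Loop "'a affine" 'a "'a list"
  | Return "'a affine" 'a bool

definition step_size :: "nat \<Rightarrow> real"
  where "step_size t = 2 / (real t + 1)"

definition next_ybar :: "'a::real_inner \<Rightarrow> 'a list \<Rightarrow> 'a \<Rightarrow> 'a"
  where "next_ybar ybar ys x =
    (let \<alpha> = step_size (length ys) in \<alpha> *\<^sub>R x + (1 - \<alpha>) *\<^sub>R ybar)"

definition next_y :: "'a::real_inner \<Rightarrow> 'a list \<Rightarrow> 'a \<Rightarrow> 'a"
  where "next_y ybar ys x =
    (let \<alpha> = step_size (length ys + 1) in \<alpha> *\<^sub>R x + (1 - \<alpha>) *\<^sub>R next_ybar ybar ys x)"

text \<open>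
  \<open>blci_step X f g xbar \<mu> \<Delta> m s n s'\<close>: the call goes from \<open>s\<close> to \<open>s'\<close> with \<open>n\<close> oracle queries.
  An iteration queries at \<open>y\<^sub>t\<^sub>-\<^sub>1\<close>, and at \<open>ybar\<^sub>t\<close> if it gets that far. The oracle returns
  \<open>f y\<close> and the subgradient \<open>g y\<close>.
\<close>

inductive blci_step ::
  "'a::real_inner set \<Rightarrow> ('a \<Rightarrow> real) \<Rightarrow> ('a \<Rightarrow> 'a) \<Rightarrow> 'a \<Rightarrow> real \<Rightarrow> real \<Rightarrow> nat \<Rightarrow>
   'a blci_state \<Rightarrow> nat \<Rightarrow> 'a blci_state \<Rightarrow> bool"
  for X f g xbar \<mu> \<Delta> m where
  empty_level:
    "{x\<in>X. aff a x \<le> f xbar - \<Delta>} = {} \<Longrightarrow>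
     blci_step X f g xbar \<mu> \<Delta> m (Entry a) 0 (Return a xbar True)"
| initial_point:
    "x0 \<in> argmin_set {x\<in>X. aff a x \<le> f xbar - \<Delta>} (\<lambda>x. (norm (x - xbar))\<^sup>2) \<Longrightarrow>
     blci_step X f g xbar \<mu> \<Delta> m (Entry a) 0 (Loop a x0 [x0])"
| model_bound:
    "bundle_inf X f g m a ys \<ge> ereal (f xbar - \<Delta>) \<Longrightarrow>
     blci_step X f g xbar \<mu> \<Delta> m (Loop a ybar ys) 1
       (Return (0, real_of_ereal (bundle_inf X f g m a ys)) xbar True)"
| far_away:
    "bundle_inf X f g m a ys < ereal (f xbar - \<Delta>) \<Longrightarrow>
     project_aggregate X f g m xbar (f xbar - \<Delta>) a ys x a' \<Longrightarrow>
     (norm (x - xbar))\<^sup>2 / \<Delta>\<^sup>2 \<ge> 2 / (\<mu> * \<Delta>) \<Longrightarrow>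
     blci_step X f g xbar \<mu> \<Delta> m (Loop a ybar ys) 1 (Return a' xbar True)"
| decrease:
    "bundle_inf X f g m a ys < ereal (f xbar - \<Delta>) \<Longrightarrow>
     project_aggregate X f g m xbar (f xbar - \<Delta>) a ys x a' \<Longrightarrow>
     (norm (x - xbar))\<^sup>2 / \<Delta>\<^sup>2 < 2 / (\<mu> * \<Delta>) \<Longrightarrow>
     f (next_ybar ybar ys x) < f xbar - 4 * \<Delta> / 5 \<Longrightarrow>
     blci_step X f g xbar \<mu> \<Delta> m (Loop a ybar ys) 2 (Return a' (next_ybar ybar ys x) False)"
| iterate:
    "bundle_inf X f g m a ys < ereal (f xbar - \<Delta>) \<Longrightarrow>
     project_aggregate X f g m xbar (f xbar - \<Delta>) a ys x a' \<Longrightarrow>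
     (norm (x - xbar))\<^sup>2 / \<Delta>\<^sup>2 < 2 / (\<mu> * \<Delta>) \<Longrightarrow>
     f (next_ybar ybar ys x) \<ge> f xbar - 4 * \<Delta> / 5 \<Longrightarrow>
     blci_step X f g xbar \<mu> \<Delta> m (Loop a ybar ys) 2
       (Loop a' (next_ybar ybar ys x) (ys @ [next_y ybar ys x]))"


section \<open>The procedure A-BLW\<close>

text \<open>
  \<open>Completed k xbar\<^sub>k \<mu>\<^sub>k \<Delta>\<^sub>k\<close>: outer iteration \<open>k\<close> has been completed (\<open>k = 0\<close>: initialization).
  The other three states occur during outer iteration \<open>k\<close>, while the call in (i), in (ii) or the
  current call in (iii) is being executed; their arguments are \<open>k\<close>, the center, the current
  values of \<open>\<mu>\<close> and \<open>\<Delta>\<close>, and the state of the call. In \<open>Second\<close> the stored \<open>\<Delta>\<close> is the value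
  set at the start of the outer iteration; the call itself uses \<open>4\<Delta>/5\<close>.
\<close>

datatype 'a blw_state =
    Completed nat 'a real real
  | First nat 'a real real "'a blci_state"
  | Second nat 'a real real "'a blci_state"
  | Halving nat 'a real real "'a blci_state"

inductive blw_step ::
  "'a::real_inner set \<Rightarrow> ('a \<Rightarrow> real) \<Rightarrow> ('a \<Rightarrow> 'a) \<Rightarrow> nat \<Rightarrow>
   'a blw_state \<Rightarrow> nat \<Rightarrow> 'a blw_state \<Rightarrow> bool"
  for X f g m where
  start_outer:
    "blw_step X f g m (Completed k xbar \<mu> \<Delta>) 0
       (First (Suc k) xbar \<mu> (3 / 4 * \<Delta>) (Entry (lin f g xbar)))"
| first_step:
    "blci_step X f g xbar \<mu> \<Delta> m s n s' \<Longrightarrow>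
     blw_step X f g m (First k xbar \<mu> \<Delta> s) n (First k xbar \<mu> \<Delta> s')"
| first_true:
    "blw_step X f g m (First k xbar \<mu> \<Delta> (Return a y True)) 0 (Completed k xbar \<mu> \<Delta>)"
| first_false:
    "blw_step X f g m (First k xbar \<mu> \<Delta> (Return a y False)) 0 (Second k xbar \<mu> \<Delta> (Entry a))"
| second_step:
    "blci_step X f g xbar \<mu> (4 * \<Delta> / 5) m s n s' \<Longrightarrow>
     blw_step X f g m (Second k xbar \<mu> \<Delta> s) n (Second k xbar \<mu> \<Delta> s')"
| second_true:
    "blw_step X f g m (Second k xbar \<mu> \<Delta> (Return a z True)) 0 (Completed k xbar \<mu> \<Delta>)"
| second_false:
    "blw_step X f g m (Second k xbar \<mu> \<Delta> (Return a z False)) 0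
       (Halving k z \<mu> \<Delta> (Entry (lin f g z)))"
| halving_step:
    "blci_step X f g xbar \<mu> \<Delta> m s n s' \<Longrightarrow>
     blw_step X f g m (Halving k xbar \<mu> \<Delta> s) n (Halving k xbar \<mu> \<Delta> s')"
| halving_true:
    "blw_step X f g m (Halving k xbar \<mu> \<Delta> (Return a y True)) 0 (Completed k xbar \<mu> \<Delta>)"
| halving_false:
    "blw_step X f g m (Halving k xbar \<mu> \<Delta> (Return a y False)) 0
       (Halving k xbar (\<mu> / 2) (2 * \<Delta>) (Entry a))"

text \<open>
  An execution: the state \<open>\<sigma> n\<close> after \<open>n\<close> steps and the number \<open>q n\<close> of queries in the step from
  \<open>\<sigma> n\<close> to \<open>\<sigma> (Suc n)\<close>. That the calls return and the outer iterations complete is not built in.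
\<close>

definition blw_run ::
  "'a::real_inner set \<Rightarrow> ('a \<Rightarrow> real) \<Rightarrow> ('a \<Rightarrow> 'a) \<Rightarrow> 'a \<Rightarrow> real \<Rightarrow> nat \<Rightarrow>
   (nat \<Rightarrow> 'a blw_state) \<Rightarrow> (nat \<Rightarrow> nat) \<Rightarrow> bool"
  where "blw_run X f g xbar0 \<mu>0 m \<sigma> q \<longleftrightarrow>
    \<sigma> 0 = Completed 0 xbar0 \<mu>0 (2 * (norm (g xbar0))\<^sup>2 / \<mu>0) \<and>
    (\<forall>n. blw_step X f g m (\<sigma> n) (q n) (\<sigma> (Suc n)))"

text \<open>The leading \<open>1\<close> is the query at \<open>xbar0\<close> made by the initialization.\<close>

definition queries_until :: "(nat \<Rightarrow> nat) \<Rightarrow> nat \<Rightarrow> nat"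
  where "queries_until q n = 1 + (\<Sum>i<n. q i)"

end

theory Submission
  imports Defs
begin

text \<open>
  A call of A-BLCI with level \<open>f c - \<Delta>\<close> projects the center \<open>c\<close> onto successive outer
  approximations of the level set. The point \<open>x\<^sub>t\<close> satisfies the aggregate cut, whose own level set
  has \<open>x\<^sub>t\<^sub>-\<^sub>1\<close> as the projection of \<open>c\<close>. Hence
  \<open>\<parallel>x\<^sub>t - c\<parallel>\<^sup>2 \<ge> \<parallel>x\<^sub>t\<^sub>-\<^sub>1 - c\<parallel>\<^sup>2 + \<parallel>x\<^sub>t - x\<^sub>t\<^sub>-\<^sub>1\<parallel>\<^sup>2\<close>, and the squared steps sum to at most the growth of
  \<open>\<parallel>x\<^sub>t - c\<parallel>\<^sup>2\<close>, which the test in step (d) keeps below \<open>2 \<Delta> / \<mu>\<close>. The accelerated averaging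
  turns this into \<open>f ybar\<^sub>t - (f c - \<Delta>) = O(M D powr (1 + \<rho>) / t powr ((1 + 3 \<rho>) / 2))\<close>, where
  \<open>D\<^sup>2\<close> is that growth. Since an unfinished call has \<open>f ybar\<^sub>t - (f c - \<Delta>) \<ge> \<Delta> / 5\<close>, the number of
  iterations is \<open>O((M\<^sup>2 \<Delta> powr (2 \<rho>) \<phi> powr (1 + \<rho>)) powr (1 / (1 + 3 \<rho>)))\<close> with
  \<open>\<phi> = D\<^sup>2 / \<Delta>\<^sup>2\<close> (\<open>loop_count\<close>, \<open>blci_call_returns\<close>).

  A call that returns True certifies that \<open>f\<close> is nowhere below the level, or that its level set
  is at distance at least \<open>sqrt (2 \<Delta> / \<mu>)\<close> from the center. Moving from the center towards a
  minimizer until the level is reached, convexity and quadratic growth then bound the optimality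
  gap by \<open>max \<Delta> (\<mu> \<Delta> / \<mu>s)\<close> (\<open>gap_le\<close>). The product \<open>\<mu>\<^sub>k \<Delta>\<^sub>k\<close> is unchanged by halvings and shrinks
  by the factor \<open>3/4\<close> in every outer iteration. Together with the decrease found by the second
  call, the gap bound keeps \<open>\<mu>\<^sub>k \<ge> \<mu>s / 4\<close> (\<open>halving_terminates\<close>), so the gap is at most
  \<open>4 \<mu>\<^sub>k \<Delta>\<^sub>k / \<mu>s\<close>. This gives the accuracy after \<open>S\<close> outer iterations and bounds the number of
  halvings by \<open>log 2 (4 \<mu>0 / \<mu>s)\<close>. The center moves only after the first call has exhibited a point
  below the level of the second call; then all minimizers lie in every outer approximation of that
  level set, and neither projecting onto such sets nor averaging increases the distance to them.

  It remains that halvings cost no logarithmic factor. The halving calls of one outer iteration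
  share the center and pass on the aggregate cut. Doubling \<open>\<Delta>\<close> at least doubles the distance from
  the center to the level set of an affine minorant, so \<open>\<parallel>x - c\<parallel>\<^sup>2 / \<Delta>\<^sup>2\<close> never decreases along these
  calls, and step (d) ends them once it reaches \<open>2 / (\<mu> \<Delta>)\<close>, which is constant. The increments \<open>\<phi>\<close> of
  the calls therefore have a bounded sum, while \<open>\<Delta>\<close> grows geometrically. The exponents of \<open>\<Delta>\<close> and
  \<open>\<phi>\<close> in the iteration bound sum to \<open>1\<close>; once it is linearized in \<open>\<Delta> / A + \<phi> / Q\<close>
  (\<open>weighted_product_le\<close>), it can be summed call by call, and up to a constant factor one outer
  iteration costs no more than a single worst call (\<open>outer_iteration\<close>). The costs of the outer
  iterations are dominated by a geometric series that ends at accuracy \<open>\<epsilon>\<close>; its ratio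
  \<open>(3/4) powr ((1 - \<rho>) / (1 + 3 \<rho>))\<close> yields the factor \<open>min (1 / (1 - \<rho>)) S\<close> (\<open>total_work_le\<close>).
\<close>

section \<open>Auxiliary inequalities and affine functions\<close>

text \<open>
  A weighted geometric mean of \<open>u / A\<close> and \<open>v / Q\<close> is at most the larger of the two. This
  is Young's inequality without its optimal constants. The right-hand side is linear in \<open>u\<close> and \<open>v\<close>;
  summing it takes the place of Hoelder's inequality and lets the bounds telescope.
\<close>

lemma weighted_product_le:
  fixes u v A Q a b :: real
  assumes "0 \<le> u" "0 \<le> v" "0 < A" "0 < Q" "0 \<le> a" "0 \<le> b" "a + b = 1"
  shows "u powr a * v powr b \<le> A powr a * Q powr b * (u / A + v / Q)"
proof (cases "u = 0 \<or> v = 0")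
  case True
  then show ?thesis using assms by auto
next
  case False
  define z where "z = max (u / A) (v / Q)"
  have pos: "u / A > 0" "v / Q > 0" "z > 0" using False assms by (auto simp: z_def less_max_iff_disj)
  have "(u / A) powr a * (v / Q) powr b \<le> z powr a * z powr b"
    using pos assms by (intro mult_mono powr_mono2) (auto simp: z_def)
  also have "\<dots> = z" using pos assms by (simp flip: powr_add)
  also have "\<dots> \<le> u / A + v / Q" using pos by (simp add: z_def)
  finally have "A powr a * Q powr b * ((u / A) powr a * (v / Q) powr b)
      \<le> A powr a * Q powr b * (u / A + v / Q)"
    by (rule mult_left_mono) simp
  also have "A powr a * Q powr b * ((u / A) powr a * (v / Q) powr b) = u powr a * v powr b"
    using assms by (simp add: powr_divide)
  finally show ?thesis .
qed

lemma aff_add: "aff (a + b) x = aff a x + aff b x"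
  by (simp add: aff_def inner_add_left)

lemma aff_scaleR: "aff (c *\<^sub>R a) x = c * aff a x"
  by (simp add: aff_def distrib_left)

lemma aff_sum: "aff (\<Sum>i\<in>I. a i) x = (\<Sum>i\<in>I. aff (a i) x)"
  by (induction I rule: infinite_finite_induct) (simp_all add: aff_add, simp_all add: aff_def)

lemma aff_diff: "aff a x - aff a y = inner (fst a) (x - y)"
  by (simp add: aff_def inner_diff_right)

lemma aff_convex: "aff a ((1 - u) *\<^sub>R x + u *\<^sub>R y) = (1 - u) * aff a x + u * aff a y"
  by (simp add: aff_def inner_add_right algebra_simps)

text \<open>
  First-order optimality along the segment from \<open>x\<close> to \<open>z\<close>: a short step towards \<open>z\<close> must not bring the
  point closer to \<open>c\<close>.
\<close>

lemma nearest_point_obtuse: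
  fixes c :: "'a::real_inner"
  assumes "convex S" "x \<in> argmin_set S (\<lambda>z. (norm (z - c))\<^sup>2)" "z \<in> S"
  shows "inner (x - c) (z - x) \<ge> 0"
proof -
  have x: "x \<in> S" and min: "\<And>y. y \<in> S \<Longrightarrow> (norm (x - c))\<^sup>2 \<le> (norm (y - c))\<^sup>2"
    using assms(2) by (auto simp: argmin_set_def)
  define n where "n = (norm (z - x))\<^sup>2"
  have lower: "- inner (x - c) (z - x) \<le> u * n" if u: "0 < u" "u \<le> 1" for u
  proof -
    have "(1 - u) *\<^sub>R x + u *\<^sub>R z \<in> S"
      using assms(1,3) x u by (auto simp: convex_alt)
    then have "(norm (x - c))\<^sup>2 \<le> (norm ((1 - u) *\<^sub>R x + u *\<^sub>R z - c))\<^sup>2" by (rule min)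
    also have "(1 - u) *\<^sub>R x + u *\<^sub>R z - c = (x - c) + u *\<^sub>R (z - x)" by (simp add: algebra_simps)
    also have "(norm \<dots>)\<^sup>2 = (norm (x - c))\<^sup>2 + 2 * u * inner (x - c) (z - x) + u\<^sup>2 * n"
      unfolding n_def power2_norm_eq_inner
      by (simp add: inner_add_left inner_add_right inner_commute power2_eq_square)
    finally have "0 \<le> u * (2 * inner (x - c) (z - x) + u * n)"
      by (simp add: algebra_simps power2_eq_square)
    then have "0 \<le> 2 * inner (x - c) (z - x) + u * n" using u by (simp add: zero_le_mult_iff)
    moreover have "0 \<le> u * n" using u by (simp add: n_def)
    ultimately show ?thesis by linarith
  qed
  show ?thesis
  proof (rule ccontr)
    assume neg: "\<not> ?thesis"
    define i where "i = - inner (x - c) (z - x)"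
    have i: "i > 0" using neg by (simp add: i_def)
    have n: "n \<ge> 0" by (simp add: n_def)
    \<comment> \<open>Any \<open>u \<le> 1\<close> with \<open>u * n < i\<close> contradicts \<open>lower\<close>.\<close>
    define u where "u = i / (i + n + n)"
    have "0 < u" "u \<le> 1" using i n by (auto simp: u_def field_simps)
    from lower[OF this] have "i \<le> u * n" by (simp add: i_def)
    moreover have "u * n < i" using i n by (simp add: u_def field_simps add_pos_nonneg)
    ultimately show False by linarith
  qed
qed

lemma norm_sq_split:
  fixes c :: "'a::real_inner"
  shows "(norm (z - c))\<^sup>2 = (norm (x - c))\<^sup>2 + (norm (z - x))\<^sup>2 + 2 * inner (x - c) (z - x)"
  unfolding power2_norm_eq_inner by (simp add: inner_diff_left inner_diff_right inner_commute)

section \<open>Cuts, distances and certificates\<close>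

locale smooth_convex =
  fixes X :: "'a::real_inner set" and f :: "'a \<Rightarrow> real" and g :: "'a \<Rightarrow> 'a"
    and \<rho> M :: real and m :: nat
  assumes convex_X: "convex X" and convex_f: "convex_on X f"
    and subgrad: "y \<in> X \<Longrightarrow> x \<in> X \<Longrightarrow> f y + inner (g y) (x - y) \<le> f x"
    and holder: "x \<in> X \<Longrightarrow> y \<in> X \<Longrightarrow>
      f y \<le> f x + inner (g x) (y - x) + M / (1 + \<rho>) * norm (y - x) powr (1 + \<rho>)"
    and rho: "0 \<le> \<rho>" "\<rho> \<le> 1" and M_pos: "0 < M" and m_pos: "1 \<le> m"
begin

definition minorant :: "'a affine \<Rightarrow> bool"
  where "minorant a \<longleftrightarrow> (\<forall>x\<in>X. aff a x \<le> f x)"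

lemma minorant_lin: "y \<in> X \<Longrightarrow> minorant (lin f g y)"
  by (simp add: minorant_def aff_lin subgrad)

text \<open>
  The squared distance from \<open>c\<close> to the level set of the cut, measured in units of \<open>\<Delta>\<^sup>2\<close>. In this
  unit the bound survives a doubling of \<open>\<Delta>\<close>.
\<close>

definition farther :: "'a \<Rightarrow> real \<Rightarrow> 'a affine \<Rightarrow> real \<Rightarrow> bool"
  where "farther c \<Delta> a w \<longleftrightarrow>
    (\<forall>z\<in>X. aff a z \<le> f c - \<Delta> \<longrightarrow> w * \<Delta>\<^sup>2 \<le> (norm (z - c))\<^sup>2)"

text \<open>
  The cut is at most \<open>f c\<close> at \<open>c\<close>, so the midpoint between \<open>c\<close> and a point of the lower level
  set lies in the higher one.
\<close>

lemma farther_double: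
  assumes "farther c \<Delta> a w" "minorant a" "c \<in> X"
  shows "farther c (2 * \<Delta>) a w"
  unfolding farther_def
proof (intro ballI impI)
  fix z assume z: "z \<in> X" "aff a z \<le> f c - 2 * \<Delta>"
  define h where "h = (1 - 1 / 2) *\<^sub>R c + (1 / 2 :: real) *\<^sub>R z"
  have "h \<in> X" using convex_X z assms unfolding h_def by (intro convexD_alt) auto
  moreover have "aff a h \<le> f c - \<Delta>"
    using z assms(2,3) unfolding h_def aff_convex minorant_def by (fastforce simp: field_simps)
  ultimately have "w * \<Delta>\<^sup>2 \<le> (norm (h - c))\<^sup>2" using assms(1) by (simp add: farther_def)
  also have "h - c = (1 / 2) *\<^sub>R (z - c)"
    by (simp add: h_def scaleR_diff_right) (simp add: algebra_simps flip: scaleR_add_left)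
  finally show "w * (2 * \<Delta>)\<^sup>2 \<le> (norm (z - c))\<^sup>2" by (simp add: power_mult_distrib power_divide)
qed

text \<open>
  Normalized multipliers make the aggregate a convex combination of minorants, and complementary
  slackness makes it equal to the level at \<open>x\<close>. Stationarity then says that \<open>x\<close> is the
  projection of the center onto the level set of the aggregate alone: one cut carries all the
  information about distances, whatever the window length \<open>m\<close>.
\<close>

lemma project_aggregate_props:
  assumes pa: "project_aggregate X f g m c l a ys x a'" and ys: "ys \<noteq> []" "set ys \<subseteq> X"
    and a: "minorant a"
  shows "x \<in> X" "aff a x \<le> l" "aff (lin f g (last ys)) x \<le> l" "minorant a'"
    "\<And>z. z \<in> X \<Longrightarrow> aff a' z \<le> l \<Longrightarrow> inner (x - c) (z - x) \<ge> 0"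
proof -
  define W where "W = window m (length ys)"
  define b where "b = (\<lambda>i. lin f g (ys ! i))"
  from pa obtain \<eta>a \<eta> s where kkt: "kkt_multipliers X c l a W b x \<eta>a \<eta>"
    and s: "s = \<eta>a + (\<Sum>i\<in>W. \<eta> i)" "s > 0"
    and a': "a' = (\<eta>a / s) *\<^sub>R a + (\<Sum>i\<in>W. (\<eta> i / s) *\<^sub>R b i)"
    unfolding project_aggregate_def Let_def W_def b_def by blast
  have W: "finite W" "length ys - 1 \<in> W" "\<And>i. i \<in> W \<Longrightarrow> i < length ys"
    using ys m_pos by (auto simp: W_def window_def)
  have nonneg: "\<eta>a \<ge> 0" "\<And>i. i \<in> W \<Longrightarrow> \<eta> i \<ge> 0" using kkt by (auto simp: kkt_multipliers_def)
  show x: "x \<in> X" "aff a x \<le> l" using kkt by (auto simp: kkt_multipliers_def)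
  show "aff (lin f g (last ys)) x \<le> l"
    using kkt W(2) ys by (auto simp: kkt_multipliers_def b_def last_conv_nth)
  have aff_a': "s * aff a' z = \<eta>a * aff a z + (\<Sum>i\<in>W. \<eta> i * aff (b i) z)" for z
    using s(2) by (simp add: a' aff_add aff_scaleR aff_sum distrib_left sum_distrib_left)
  have at_x: "aff a' x = l"
  proof -
    have "\<eta>a * aff a x = \<eta>a * l" "\<And>i. i \<in> W \<Longrightarrow> \<eta> i * aff (b i) x = \<eta> i * l"
      using kkt by (auto simp: kkt_multipliers_def)
    then have "s * aff a' x = \<eta>a * l + (\<Sum>i\<in>W. \<eta> i * l)"
      unfolding aff_a' by (intro arg_cong2[of _ _ _ _ "(+)"] sum.cong) auto
    also have "\<dots> = s * l" by (simp only: s(1) distrib_right sum_distrib_right)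
    finally have "s * aff a' x = s * l" .
    then show ?thesis using s(2) by simp
  qed
  show "minorant a'"
    unfolding minorant_def
  proof
    fix z assume z: "z \<in> X"
    have "minorant (b i)" if "i \<in> W" for i
      unfolding b_def using ys W(3)[OF that] by (intro minorant_lin) auto
    then have "s * aff a' z \<le> \<eta>a * f z + (\<Sum>i\<in>W. \<eta> i * f z)"
      unfolding aff_a' using nonneg a z
      by (intro add_mono sum_mono mult_left_mono) (auto simp: minorant_def)
    also have "\<dots> = s * f z" by (simp add: s(1) distrib_right sum_distrib_right)
    finally show "aff a' z \<le> f z" using s(2) by simp
  qed
  show "inner (x - c) (z - x) \<ge> 0" if z: "z \<in> X" "aff a' z \<le> l" for z
  proof -
    have "inner (\<eta>a *\<^sub>R fst a + (\<Sum>i\<in>W. \<eta> i *\<^sub>R fst (b i))) (z - x) = s * aff a' z - s * aff a' x"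
      unfolding aff_a'
      by (simp add: inner_add_left inner_sum_left aff_diff[symmetric] right_diff_distrib
          sum_subtractf)
    also have "\<dots> \<le> 0" using z(2) s(2) at_x by simp
    finally have le: "inner (\<eta>a *\<^sub>R fst a + (\<Sum>i\<in>W. \<eta> i *\<^sub>R fst (b i))) (z - x) \<le> 0" .
    have "inner (- (2 *\<^sub>R (x - c) + \<eta>a *\<^sub>R fst a + (\<Sum>i\<in>W. \<eta> i *\<^sub>R fst (b i)))) (z - x) \<le> 0"
      using kkt z(1) by (simp add: kkt_multipliers_def)
    with le show ?thesis by (simp add: inner_add_left inner_diff_left inner_minus_left)
  qed
qed

lemma model_bound_imp_level_bound:
  assumes "bundle_inf X f g m a ys \<ge> ereal l" "ys \<noteq> []" "set ys \<subseteq> X" "minorant a" "z \<in> X"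
  shows "l \<le> f z"
proof -
  define W where "W = window m (length ys)"
  have W: "finite W" "length ys - 1 \<in> W" "\<And>i. i \<in> W \<Longrightarrow> i < length ys"
    using assms m_pos by (auto simp: W_def window_def)
  have "ereal l \<le> ereal (bundle_model f g m a ys z)"
    using assms(1,5) unfolding bundle_inf_def by (auto simp: le_INF_iff)
  also have "bundle_model f g m a ys z \<le> f z"
    unfolding bundle_model_def W_def[symmetric] using W assms(3-5)
    by (intro max.boundedI Max.boundedI) (auto simp: minorant_def aff_lin intro!: subgrad)
  finally show ?thesis by simp
qed

section \<open>The accelerated energy estimate of one call\<close>

text \<open>
  The state before iteration \<open>t + 1\<close>, where \<open>x\<close> is the projection \<open>x\<^sub>t\<close> and \<open>w\<close> the normalized
  squared distance known when the call was entered. The last conjunct is the energy estimate. It is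
  stated for all scales \<open>A\<close> and \<open>Q\<close>, because the best scales depend on the value of \<open>t\<close> at which the
  call ends.
\<close>

definition loop_inv ::
    "'a \<Rightarrow> real \<Rightarrow> real \<Rightarrow> nat \<Rightarrow> 'a affine \<Rightarrow> 'a \<Rightarrow> 'a list \<Rightarrow> 'a \<Rightarrow> bool"
  where "loop_inv c \<Delta> w t a ybar ys x \<longleftrightarrow>
    length ys = Suc t \<and> set ys \<subseteq> X \<and> x \<in> X \<and> ybar \<in> X \<and> minorant a \<and>
    (\<forall>z\<in>X. aff a z \<le> f c - \<Delta> \<longrightarrow> inner (x - c) (z - x) \<ge> 0) \<and>
    last ys = step_size (Suc t) *\<^sub>R x + (1 - step_size (Suc t)) *\<^sub>R ybar \<and>
    w * \<Delta>\<^sup>2 \<le> (norm (x - c))\<^sup>2 \<and>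
    (\<forall>p\<in>X. f p \<le> f c - \<Delta> \<longrightarrow> norm (ybar - p) \<le> norm (c - p)) \<and>
    (\<forall>A>0. \<forall>Q>0. real t * (real t + 1) * (f ybar - (f c - \<Delta>)) \<le>
       4 * M * (A powr ((1 - \<rho>) / 2) * Q powr ((1 + \<rho>) / 2)) *
       (real t ^ 3 / A + ((norm (x - c))\<^sup>2 - w * \<Delta>\<^sup>2) / Q))"

text \<open>
  An obtuse angle at \<open>x\<close> makes the segment from \<open>c\<close> to \<open>p\<close> the longest side of the triangle. With
  \<open>p\<close> in the level set, the first part is Fejer monotonicity, the second one monotonicity of the
  distances from the center.
\<close>

lemma obtuse_imp_closer:
  assumes "inner (x - c) (p - x) \<ge> 0"
  shows "norm (x - p) \<le> norm (c - p)" "(norm (x - c))\<^sup>2 \<le> (norm (p - c))\<^sup>2"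
proof -
  have eq: "(norm (p - c))\<^sup>2 = (norm (x - c))\<^sup>2 + (norm (p - x))\<^sup>2 + 2 * inner (x - c) (p - x)"
    by (rule norm_sq_split)
  have "(norm (x - p))\<^sup>2 \<le> (norm (c - p))\<^sup>2"
    using eq assms zero_le_power2[of "norm (x - c)"] by (simp only: norm_minus_commute[of x p] norm_minus_commute[of c p])
  then show "norm (x - p) \<le> norm (c - p)" by (rule power2_le_imp_le) simp
  show "(norm (x - c))\<^sup>2 \<le> (norm (p - c))\<^sup>2"
    using eq assms zero_le_power2[of "norm (p - x)"] by linarith
qed

lemma loop_inv_init:
  assumes x0: "x0 \<in> argmin_set {x\<in>X. aff a x \<le> f c - \<Delta>} (\<lambda>x. (norm (x - c))\<^sup>2)"
    and a: "minorant a" and far: "farther c \<Delta> a w"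
  shows "loop_inv c \<Delta> w 0 a x0 [x0] x0"
proof -
  have mem: "x0 \<in> X" "aff a x0 \<le> f c - \<Delta>" using x0 by (auto simp: argmin_set_def)
  have "convex {x\<in>X. aff a x \<le> f c - \<Delta>}"
    using convex_X by (auto simp: convex_alt aff_convex intro: convex_bound_le)
  then have obt: "\<forall>z\<in>X. aff a z \<le> f c - \<Delta> \<longrightarrow> inner (x0 - c) (z - x0) \<ge> 0"
    using nearest_point_obtuse[OF _ x0] by blast
  have "\<forall>p\<in>X. f p \<le> f c - \<Delta> \<longrightarrow> norm (x0 - p) \<le> norm (c - p)"
  proof (intro ballI impI)
    fix p assume p: "p \<in> X" "f p \<le> f c - \<Delta>"
    then have "aff a p \<le> f c - \<Delta>" using a unfolding minorant_def by (meson order_trans)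
    then show "norm (x0 - p) \<le> norm (c - p)" using obt p(1) obtuse_imp_closer(1) by blast
  qed
  then show ?thesis
    using mem obt a far M_pos unfolding loop_inv_def by (auto simp: farther_def step_size_def)
qed

text \<open>
  The points \<open>y\<close> and \<open>ybar'\<close> use the same weights, so they differ by \<open>\<alpha> * (x' - x)\<close>. The linearization at
  \<open>y\<close> is below \<open>f\<close> at \<open>ybar\<close> and below the level at \<open>x'\<close>, because it is one of the cuts that
  \<open>x'\<close> satisfies.
\<close>

lemma accelerated_decrease:
  assumes "x \<in> X" "x' \<in> X" "ybar \<in> X" "0 \<le> \<alpha>" "\<alpha> \<le> 1"
    and y: "y = \<alpha> *\<^sub>R x + (1 - \<alpha>) *\<^sub>R ybar" and ybar': "ybar' = \<alpha> *\<^sub>R x' + (1 - \<alpha>) *\<^sub>R ybar"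
    and cut: "aff (lin f g y) x' \<le> l"
  shows "f ybar' - l \<le> (1 - \<alpha>) * (f ybar - l) + M * (\<alpha> * norm (x' - x)) powr (1 + \<rho>)"
proof -
  have yX: "y \<in> X" "ybar' \<in> X" using assms convex_X by (auto simp: convex_def)
  have dist: "norm (ybar' - y) = \<alpha> * norm (x' - x)"
    using assms(4) by (simp add: y ybar' flip: scaleR_diff_right)
  have "f ybar' \<le> f y + inner (g y) (ybar' - y) + M / (1 + \<rho>) * (\<alpha> * norm (x' - x)) powr (1 + \<rho>)"
    using holder[OF yX] by (simp only: dist)
  also have "f y + inner (g y) (ybar' - y) = aff (lin f g y) ((1 - \<alpha>) *\<^sub>R ybar + \<alpha> *\<^sub>R x')"
    by (simp add: aff_lin ybar' add.commute)
  also have "\<dots> = (1 - \<alpha>) * aff (lin f g y) ybar + \<alpha> * aff (lin f g y) x'"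
    by (rule aff_convex)
  also have "\<dots> \<le> (1 - \<alpha>) * f ybar + \<alpha> * l"
    using assms minorant_lin[OF yX(1)] by (intro add_mono mult_left_mono) (auto simp: minorant_def)
  also have "M / (1 + \<rho>) * (\<alpha> * norm (x' - x)) powr (1 + \<rho>) \<le> M * (\<alpha> * norm (x' - x)) powr (1 + \<rho>)"
    using rho M_pos by (intro mult_right_mono) (auto simp: field_simps)
  finally show ?thesis by (simp add: algebra_simps)
qed

text \<open>
  With \<open>\<alpha> = 2 / (s + 1)\<close> one has \<open>s * (s + 1) * (1 - \<alpha>) = (s - 1) * s\<close>, so the weights
  \<open>s * (s + 1)\<close> make the recursion of \<open>accelerated_decrease\<close> telescope. The lemma bounds the weighted
  smoothness error and writes it in the form to which \<open>weighted_product_le\<close> applies.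
\<close>

lemma step_weight:
  fixes s :: real
  assumes s: "s \<ge> 1" and r: "r \<ge> 0"
  shows "s * (s + 1) * (2 / (s + 1) * r) powr (1 + \<rho>) \<le> 4 * ((s\<^sup>2) powr ((1 - \<rho>) / 2) * (r\<^sup>2) powr ((1 + \<rho>) / 2))"
proof -
  have sq: "(v\<^sup>2) powr (e / 2) = v powr e" if "v \<ge> 0" for v e :: real
  proof (cases "v = 0")
    case False
    then have "v\<^sup>2 = v powr 2" using that by simp
    then show ?thesis by (simp only: powr_powr) simp
  qed simp
  have "s * (s + 1) * (2 / (s + 1)) powr (1 + \<rho>) = 2 powr (1 + \<rho>) * (s * (s + 1) powr (- \<rho>))"
  proof -
    have "(2 / (s + 1)) powr (1 + \<rho>) = 2 powr (1 + \<rho>) / ((s + 1) * (s + 1) powr \<rho>)"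
      using s by (simp add: powr_divide powr_add)
    then show ?thesis using s by (simp add: powr_minus divide_inverse)
  qed
  also have "\<dots> \<le> 2 powr 2 * (s * s powr (- \<rho>))"
    using s rho by (intro mult_mono powr_mono powr_mono2') auto
  also have "\<dots> = 4 * s powr (1 - \<rho>)"
    using s by (simp add: powr_diff powr_minus field_simps)
  finally have "s * (s + 1) * (2 / (s + 1)) powr (1 + \<rho>) * r powr (1 + \<rho>) \<le> 4 * s powr (1 - \<rho>) * r powr (1 + \<rho>)"
    by (rule mult_right_mono) simp
  moreover have "(2 / (s + 1) * r) powr (1 + \<rho>) = (2 / (s + 1)) powr (1 + \<rho>) * r powr (1 + \<rho>)"
    using s r by (intro powr_mult)
  ultimately show ?thesis using s r by (simp add: sq mult.assoc)
qed

lemma loop_inv_step: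
  assumes inv: "loop_inv c \<Delta> w t a ybar ys x"
    and pa: "project_aggregate X f g m c (f c - \<Delta>) a ys x' a'"
  shows "loop_inv c \<Delta> w (Suc t) a' (next_ybar ybar ys x') (ys @ [next_y ybar ys x']) x'"
    and "(norm (x - c))\<^sup>2 \<le> (norm (x' - c))\<^sup>2"
proof -
  let ?l = "f c - \<Delta>"
  have len: "length ys = Suc t" and ysX: "set ys \<subseteq> X" and x: "x \<in> X" and ybar: "ybar \<in> X"
    and a: "minorant a" and obt: "\<And>z. z \<in> X \<Longrightarrow> aff a z \<le> ?l \<Longrightarrow> inner (x - c) (z - x) \<ge> 0"
    and last: "last ys = step_size (Suc t) *\<^sub>R x + (1 - step_size (Suc t)) *\<^sub>R ybar"
    and w: "w * \<Delta>\<^sup>2 \<le> (norm (x - c))\<^sup>2"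
    and fejer: "\<And>p. p \<in> X \<Longrightarrow> f p \<le> ?l \<Longrightarrow> norm (ybar - p) \<le> norm (c - p)"
    and energy: "\<And>A Q. A > 0 \<Longrightarrow> Q > 0 \<Longrightarrow> real t * (real t + 1) * (f ybar - ?l) \<le>
       4 * M * (A powr ((1 - \<rho>) / 2) * Q powr ((1 + \<rho>) / 2)) *
       (real t ^ 3 / A + ((norm (x - c))\<^sup>2 - w * \<Delta>\<^sup>2) / Q)"
    using inv unfolding loop_inv_def by blast+
  have ne: "ys \<noteq> []" using len by auto
  note P = project_aggregate_props[OF pa ne ysX a]
  define \<alpha> where "\<alpha> = step_size (Suc t)"
  have \<alpha>: "0 \<le> \<alpha>" "\<alpha> \<le> 1" and \<alpha>_eq: "\<alpha> = 2 / (real (Suc t) + 1)" by (auto simp: \<alpha>_def step_size_def)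
  define \<beta> where "\<beta> = step_size (Suc (Suc t))"
  have \<beta>: "0 \<le> \<beta>" "\<beta> \<le> 1" by (auto simp: \<beta>_def step_size_def)
  let ?yb = "next_ybar ybar ys x'"
  have yb: "?yb = \<alpha> *\<^sub>R x' + (1 - \<alpha>) *\<^sub>R ybar" by (simp add: next_ybar_def len \<alpha>_def Let_def)
  have ny: "next_y ybar ys x' = \<beta> *\<^sub>R x' + (1 - \<beta>) *\<^sub>R ?yb" by (simp add: next_y_def len \<beta>_def Let_def)
  have ybX: "?yb \<in> X" unfolding yb using convex_X P(1) ybar \<alpha> by (auto simp: convex_def)
  have nyX: "next_y ybar ys x' \<in> X" unfolding ny using convex_X P(1) ybX \<beta> by (auto simp: convex_def)
  have obt_x': "inner (x - c) (x' - x) \<ge> 0" using obt P(1,2) by blast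
  then show mono: "(norm (x - c))\<^sup>2 \<le> (norm (x' - c))\<^sup>2" by (rule obtuse_imp_closer)
  have incr: "(norm (x' - x))\<^sup>2 \<le> (norm (x' - c))\<^sup>2 - (norm (x - c))\<^sup>2"
    using norm_sq_split[of x' c x] obt_x' by linarith
  have fejer': "norm (?yb - p) \<le> norm (c - p)" if p: "p \<in> X" "f p \<le> ?l" for p
  proof -
    have "aff a' p \<le> ?l" using P(4) p by (auto simp: minorant_def intro: order_trans)
    then have "norm (x' - p) \<le> norm (c - p)" using P(5) p obtuse_imp_closer(1) by blast
    moreover have "?yb - p = \<alpha> *\<^sub>R (x' - p) + (1 - \<alpha>) *\<^sub>R (ybar - p)"
      unfolding yb by (simp add: algebra_simps)
    then have "norm (?yb - p) \<le> \<alpha> * norm (x' - p) + (1 - \<alpha>) * norm (ybar - p)"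
      using \<alpha> norm_triangle_ineq[of "\<alpha> *\<^sub>R (x' - p)" "(1 - \<alpha>) *\<^sub>R (ybar - p)"] by simp
    ultimately show ?thesis using fejer[OF p] \<alpha>
      by (meson convex_bound_le diff_add_cancel diff_ge_0_iff_ge order_trans add.commute le_add_diff_inverse)
  qed
  define s where "s = real (Suc t)"
  have s: "s \<ge> 1" "s * (s + 1) * (1 - \<alpha>) = real t * (real t + 1)" "s - 1 = real t"
    by (auto simp: s_def \<alpha>_eq field_simps)
  have energy': "s * (s + 1) * (f ?yb - ?l) \<le>
       4 * M * (A powr ((1 - \<rho>) / 2) * Q powr ((1 + \<rho>) / 2)) *
       (s ^ 3 / A + ((norm (x' - c))\<^sup>2 - w * \<Delta>\<^sup>2) / Q)" if AQ: "A > 0" "Q > 0" for A Q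
  proof -
    define K where "K = 4 * M * (A powr ((1 - \<rho>) / 2) * Q powr ((1 + \<rho>) / 2))"
    have K: "K \<ge> 0" using M_pos by (simp add: K_def)
    define r where "r = norm (x' - x)"
    have "f ?yb - ?l \<le> (1 - \<alpha>) * (f ybar - ?l) + M * (\<alpha> * r) powr (1 + \<rho>)"
      unfolding r_def by (rule accelerated_decrease[OF x P(1) ybar \<alpha> last[folded \<alpha>_def] yb P(3)])
    then have "s * (s + 1) * (f ?yb - ?l)
        \<le> s * (s + 1) * ((1 - \<alpha>) * (f ybar - ?l) + M * (\<alpha> * r) powr (1 + \<rho>))"
      using s(1) by (intro mult_left_mono) auto
    also have "\<dots> = real t * (real t + 1) * (f ybar - ?l)
        + M * (s * (s + 1) * (2 / (s + 1) * r) powr (1 + \<rho>))"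
      by (simp only: s(2)[symmetric] \<alpha>_eq[folded s_def]) (simp add: algebra_simps)
    also have "\<dots> \<le> K * (real t ^ 3 / A + ((norm (x - c))\<^sup>2 - w * \<Delta>\<^sup>2) / Q)
        + M * (4 * (A powr ((1 - \<rho>) / 2) * Q powr ((1 + \<rho>) / 2) * (s\<^sup>2 / A + r\<^sup>2 / Q)))"
    proof (intro add_mono mult_left_mono)
      have "(s\<^sup>2) powr ((1 - \<rho>) / 2) * (r\<^sup>2) powr ((1 + \<rho>) / 2)
          \<le> A powr ((1 - \<rho>) / 2) * Q powr ((1 + \<rho>) / 2) * (s\<^sup>2 / A + r\<^sup>2 / Q)"
        using rho AQ by (intro weighted_product_le) (auto simp: field_simps)
      with step_weight[OF s(1), of r]
      show "s * (s + 1) * (2 / (s + 1) * r) powr (1 + \<rho>) \<le>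
          4 * (A powr ((1 - \<rho>) / 2) * Q powr ((1 + \<rho>) / 2) * (s\<^sup>2 / A + r\<^sup>2 / Q))"
        by (simp add: r_def)
    qed (use energy[OF AQ] M_pos K_def in auto)
    also have "\<dots> = K * ((real t ^ 3 + s\<^sup>2) / A + ((norm (x - c))\<^sup>2 - w * \<Delta>\<^sup>2 + r\<^sup>2) / Q)"
      by (simp only: K_def add_divide_distrib) (simp only: distrib_left distrib_right mult_ac add_ac)
    also have "\<dots> \<le> K * (s ^ 3 / A + ((norm (x' - c))\<^sup>2 - w * \<Delta>\<^sup>2) / Q)"
    proof (intro mult_left_mono[OF _ K] add_mono divide_right_mono)
      show "real t ^ 3 + s\<^sup>2 \<le> s ^ 3"
        by (simp add: s_def power2_eq_square power3_eq_cube algebra_simps)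
      show "(norm (x - c))\<^sup>2 - w * \<Delta>\<^sup>2 + r\<^sup>2 \<le> (norm (x' - c))\<^sup>2 - w * \<Delta>\<^sup>2"
        using incr by (simp add: r_def)
    qed (use AQ in auto)
    finally show ?thesis by (simp add: K_def)
  qed
  show "loop_inv c \<Delta> w (Suc t) a' ?yb (ys @ [next_y ybar ys x']) x'"
    unfolding loop_inv_def
  proof (intro conjI)
    show "w * \<Delta>\<^sup>2 \<le> (norm (x' - c))\<^sup>2" using w mono by linarith
    show "last (ys @ [next_y ybar ys x'])
      = step_size (Suc (Suc t)) *\<^sub>R x' + (1 - step_size (Suc (Suc t))) *\<^sub>R ?yb"
      using ny by (simp add: \<beta>_def)
    show "\<forall>A>0. \<forall>Q>0. real (Suc t) * (real (Suc t) + 1) * (f ?yb - ?l) \<le>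
       4 * M * (A powr ((1 - \<rho>) / 2) * Q powr ((1 + \<rho>) / 2)) *
       (real (Suc t) ^ 3 / A + ((norm (x' - c))\<^sup>2 - w * \<Delta>\<^sup>2) / Q)"
      using energy' unfolding s_def by blast
    show "set (ys @ [next_y ybar ys x']) \<subseteq> X" using ysX nyX by simp
    show "\<forall>p\<in>X. f p \<le> ?l \<longrightarrow> norm (?yb - p) \<le> norm (c - p)" using fejer' by blast
    show "\<forall>z\<in>X. aff a' z \<le> ?l \<longrightarrow> 0 \<le> inner (x' - c) (z - x')" using P(5) by blast
  qed (use len P(1,4) ybX in \<open>simp_all only: length_append_singleton simp_thms\<close>)
qed

section \<open>Counting the iterations of one call\<close>

text \<open>
  Up to a constant factor, an upper bound for the number of iterations of a call with level gap
  \<open>A\<close> during which the normalized squared distance grows by \<open>Q\<close>.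
\<close>

definition work :: "real \<Rightarrow> real \<Rightarrow> real"
  where "work A Q = (M\<^sup>2 * A powr (2 * \<rho>) * Q powr (1 + \<rho>)) powr (1 / (1 + 3 * \<rho>))"

lemma work_nonneg: "work A Q \<ge> 0" by (simp add: work_def)

text \<open>
  While the call goes on, \<open>f ybar\<close> exceeds the level by at least \<open>\<Delta> / 5\<close>. The energy estimate at the
  scale \<open>t ^ 3\<close> and the growth of the squared distance turns this into a bound on \<open>t\<close>. That bound is a product of
  powers of \<open>\<Delta>\<close> and of the normalized growth whose exponents sum to \<open>1\<close>, so it can be linearized
  at any reference values \<open>A\<close> and \<open>Q\<close>.
\<close>

lemma loop_count:
  assumes inv: "loop_inv c \<Delta> w t a ybar ys x"
    and high: "t > 0 \<Longrightarrow> f c - 4 * \<Delta> / 5 \<le> f ybar"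
    and pos: "\<Delta> > 0" "A > 0" "Q > 0"
  shows "real t \<le> 1600 * work A Q * (2 * \<Delta> / A + ((norm (x - c))\<^sup>2 / \<Delta>\<^sup>2 - w) / Q)"
proof (cases "t = 0")
  case True
  have "w \<le> (norm (x - c))\<^sup>2 / \<Delta>\<^sup>2"
    using inv pos by (simp add: loop_inv_def field_simps)
  then have "0 \<le> 1600 * work A Q * (2 * \<Delta> / A + ((norm (x - c))\<^sup>2 / \<Delta>\<^sup>2 - w) / Q)"
    using pos by (intro mult_nonneg_nonneg add_nonneg_nonneg) (auto simp: work_nonneg)
  then show ?thesis using True by simp
next
  case False
  define T where "T = real t"
  define \<phi> where "\<phi> = (norm (x - c))\<^sup>2 / \<Delta>\<^sup>2 - w"
  have \<phi>: "\<phi> \<ge> 0" using inv pos by (simp add: loop_inv_def field_simps \<phi>_def)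
  \<comment> \<open>The second summand keeps \<open>\<psi>\<close> positive when the projections have not moved. Its contribution
    \<open>\<Delta> / A\<close> is the reason for the factor \<open>2\<close> in the claim.\<close>
  define \<psi> where "\<psi> = \<phi> + \<Delta> * Q / A"
  have \<psi>: "\<psi> > 0" using \<phi> pos by (simp add: \<psi>_def add_nonneg_pos)
  define a' where "a' = (1 - \<rho>) / 2"
  define b' where "b' = (1 + \<rho>) / 2"
  have T: "T \<ge> 1" using False by (simp add: T_def)
  have "T * (T + 1) * (f ybar - (f c - \<Delta>)) \<le>
       4 * M * ((T ^ 3) powr a' * (\<psi> * \<Delta>\<^sup>2) powr b') *
       (T ^ 3 / T ^ 3 + ((norm (x - c))\<^sup>2 - w * \<Delta>\<^sup>2) / (\<psi> * \<Delta>\<^sup>2))"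
  proof -
    have "T ^ 3 > 0" "\<psi> * \<Delta>\<^sup>2 > 0" using T \<psi> pos by auto
    then show ?thesis using inv unfolding loop_inv_def T_def a'_def b'_def by blast
  qed
  also have "\<dots> \<le> 4 * M * ((T ^ 3) powr a' * (\<psi> * \<Delta>\<^sup>2) powr b') * 2"
  proof (rule mult_left_mono)
    have "(norm (x - c))\<^sup>2 - w * \<Delta>\<^sup>2 = \<phi> * \<Delta>\<^sup>2" using pos by (simp add: \<phi>_def field_simps)
    also have "\<dots> / (\<psi> * \<Delta>\<^sup>2) \<le> 1" using pos \<psi> \<phi> by (simp add: \<psi>_def)
    finally show "T ^ 3 / T ^ 3 + ((norm (x - c))\<^sup>2 - w * \<Delta>\<^sup>2) / (\<psi> * \<Delta>\<^sup>2) \<le> 2" using T by simp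
  qed (use M_pos in auto)
  finally have upper: "T * (T + 1) * (f ybar - (f c - \<Delta>)) \<le> 8 * M * ((T ^ 3) powr a' * (\<psi> * \<Delta>\<^sup>2) powr b')"
    by simp
  have "T\<^sup>2 * (\<Delta> / 5) \<le> T * (T + 1) * (f ybar - (f c - \<Delta>))"
    using high False T pos by (intro mult_mono) (auto simp: power2_eq_square)
  also note upper
  finally have "T\<^sup>2 * \<Delta> \<le> 40 * M * ((T ^ 3) powr a' * (\<psi> * \<Delta>\<^sup>2) powr b')" by simp
  then have "(T\<^sup>2 * \<Delta>)\<^sup>2 \<le> (40 * M * ((T ^ 3) powr a' * (\<psi> * \<Delta>\<^sup>2) powr b'))\<^sup>2"
    using pos by (intro power_mono) auto
  also have "\<dots> = 1600 * M\<^sup>2 * ((T ^ 3) powr (1 - \<rho>) * (\<psi> * \<Delta>\<^sup>2) powr (1 + \<rho>))"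
  proof -
    have "(u powr (e / 2))\<^sup>2 = u powr e" for u e :: real by (simp add: power2_eq_square flip: powr_add)
    then show ?thesis by (simp add: power_mult_distrib a'_def b'_def)
  qed
  also have "\<dots> = 1600 * M\<^sup>2 * (T powr (3 - 3 * \<rho>) * (\<psi> powr (1 + \<rho>) * \<Delta> powr (2 + 2 * \<rho>)))"
  proof -
    have "T ^ 3 = T powr 3" "\<Delta>\<^sup>2 = \<Delta> powr 2" using T pos by simp_all
    then have "(T ^ 3) powr (1 - \<rho>) = T powr (3 * (1 - \<rho>))"
      "(\<psi> * \<Delta>\<^sup>2) powr (1 + \<rho>) = \<psi> powr (1 + \<rho>) * \<Delta> powr (2 * (1 + \<rho>))"
      using \<psi> by (simp_all only: powr_powr powr_mult less_imp_le powr_ge_zero)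
    then show ?thesis by (simp add: right_diff_distrib distrib_left)
  qed
  finally have "(T\<^sup>2 * \<Delta>)\<^sup>2 \<le> 1600 * M\<^sup>2 * (T powr (3 - 3 * \<rho>) * (\<psi> powr (1 + \<rho>) * \<Delta> powr (2 + 2 * \<rho>)))" .
  moreover have "(T\<^sup>2 * \<Delta>)\<^sup>2 = T powr 4 * \<Delta> powr 2"
    using T pos by (simp add: power_mult_distrib)
  moreover have "T powr 4 = T powr (1 + 3 * \<rho>) * T powr (3 - 3 * \<rho>)" by (simp flip: powr_add)
  moreover have "\<Delta> powr (2 + 2 * \<rho>) = \<Delta> powr (2 * \<rho>) * \<Delta> powr 2" by (simp add: add.commute flip: powr_add)
  ultimately have "T powr (1 + 3 * \<rho>) * (T powr (3 - 3 * \<rho>) * \<Delta> powr 2)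
      \<le> 1600 * M\<^sup>2 * (\<psi> powr (1 + \<rho>) * \<Delta> powr (2 * \<rho>)) * (T powr (3 - 3 * \<rho>) * \<Delta> powr 2)"
    by (simp add: mult_ac)
  then have main: "T powr (1 + 3 * \<rho>) \<le> 1600 * (M\<^sup>2 * (\<Delta> powr (2 * \<rho>) * \<psi> powr (1 + \<rho>)))"
    using T pos by (simp add: mult_ac)
  define e where "e = 1 / (1 + 3 * \<rho>)"
  have e: "0 < e" "e \<le> 1" "(1 + 3 * \<rho>) * e = 1" "2 * \<rho> * e + (1 + \<rho>) * e = 1"
  proof -
    have "1 + 3 * \<rho> > 0" using rho by linarith
    then show "0 < e" "e \<le> 1" "(1 + 3 * \<rho>) * e = 1" using rho by (auto simp: e_def)
    then show "2 * \<rho> * e + (1 + \<rho>) * e = 1" by (simp add: algebra_simps)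
  qed
  have "T = (T powr (1 + 3 * \<rho>)) powr e" using T e by (simp add: powr_powr)
  also have "\<dots> \<le> (1600 * (M\<^sup>2 * (\<Delta> powr (2 * \<rho>) * \<psi> powr (1 + \<rho>)))) powr e"
    using main e by (intro powr_mono2) auto
  also have "\<dots> = 1600 powr e * ((M\<^sup>2) powr e * (\<Delta> powr (2 * \<rho> * e) * \<psi> powr ((1 + \<rho>) * e)))"
    using M_pos by (simp add: powr_mult powr_powr)
  also have "\<dots> \<le> 1600 powr 1 * ((M\<^sup>2) powr e *
      (A powr (2 * \<rho> * e) * Q powr ((1 + \<rho>) * e) * (\<Delta> / A + \<psi> / Q)))"
  proof (rule mult_mono)
    have "\<Delta> powr (2 * \<rho> * e) * \<psi> powr ((1 + \<rho>) * e)
        \<le> A powr (2 * \<rho> * e) * Q powr ((1 + \<rho>) * e) * (\<Delta> / A + \<psi> / Q)"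
      using e rho pos \<psi> by (intro weighted_product_le) auto
    then show "(M\<^sup>2) powr e * (\<Delta> powr (2 * \<rho> * e) * \<psi> powr ((1 + \<rho>) * e)) \<le> (M\<^sup>2) powr e *
      (A powr (2 * \<rho> * e) * Q powr ((1 + \<rho>) * e) * (\<Delta> / A + \<psi> / Q))"
      by (rule mult_left_mono) simp
  qed (use e powr_mono[of e 1 1600] in auto)
  also have "\<dots> = 1600 * work A Q * (\<Delta> / A + \<psi> / Q)"
    using M_pos by (simp add: work_def powr_mult powr_powr e_def)
  also have "\<Delta> / A + \<psi> / Q = 2 * \<Delta> / A + \<phi> / Q" using pos by (simp add: \<psi>_def field_simps)
  finally show ?thesis by (simp add: T_def \<phi>_def)
qed

section \<open>Termination and cost of one call\<close>

definition certificate :: "'a \<Rightarrow> real \<Rightarrow> real \<Rightarrow> bool"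
  where "certificate c \<mu> \<Delta> \<longleftrightarrow> (\<forall>z\<in>X. f c - \<Delta> \<le> f z) \<or>
    (\<forall>z\<in>X. f z \<le> f c - \<Delta> \<longrightarrow> 2 * \<Delta> / \<mu> \<le> (norm (z - c))\<^sup>2)"

definition decrease_found :: "'a \<Rightarrow> real \<Rightarrow> 'a affine \<Rightarrow> 'a \<Rightarrow> real \<Rightarrow> bool"
  where "decrease_found c \<Delta> a y w \<longleftrightarrow> minorant a \<and> y \<in> X \<and> f y < f c - 4 * \<Delta> / 5 \<and>
    farther c \<Delta> a w \<and> (\<forall>p\<in>X. f p \<le> f c - \<Delta> \<longrightarrow> norm (y - p) \<le> norm (c - p))"

lemma loop_inv_farther:
  assumes "loop_inv c \<Delta> w t a ybar ys x" "\<Delta> > 0"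
  shows "farther c \<Delta> a ((norm (x - c))\<^sup>2 / \<Delta>\<^sup>2)"
  unfolding farther_def
proof (intro ballI impI)
  fix z assume "z \<in> X" "aff a z \<le> f c - \<Delta>"
  then have "inner (x - c) (z - x) \<ge> 0" using assms(1) by (simp add: loop_inv_def)
  then show "(norm (x - c))\<^sup>2 / \<Delta>\<^sup>2 * \<Delta>\<^sup>2 \<le> (norm (z - c))\<^sup>2"
    using obtuse_imp_closer(2) assms(2) by simp
qed

text \<open>
  The function \<open>W\<close> places the states of the call inside the states of the surrounding procedure, so
  that one lemma serves all three kinds of calls. Every iteration costs at most two queries: the
  iterations that do not end the call are counted by \<open>loop_count\<close>, and the last one gives the
  constant \<open>2\<close>.
  The cost depends on the growth \<open>w' - w\<close> of the normalized distance, and \<open>w'\<close> holds for the returned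
  aggregate; therefore the costs of successive calls with the same center telescope.
\<close>

lemma blci_call_returns:
  fixes \<sigma> :: "nat \<Rightarrow> 's" and W :: "'a blci_state \<Rightarrow> 's" and q :: "nat \<Rightarrow> nat"
  assumes step: "\<And>i s. \<sigma> i = W s \<Longrightarrow> (\<forall>a y b. s \<noteq> Return a y b) \<Longrightarrow>
      \<exists>s'. \<sigma> (Suc i) = W s' \<and> blci_step X f g c \<mu> \<Delta> m s (q i) s'"
    and start: "\<sigma> n = W (Entry a)"
    and c: "c \<in> X" and a: "minorant a" and far: "farther c \<Delta> a w"
    and w: "w \<le> 2 / (\<mu> * \<Delta>)"
    and pos: "\<mu> > 0" "\<Delta> > 0" "A > 0" "Q > 0"
  shows "\<exists>n' a' y b w'. n \<le> n' \<and> \<sigma> n' = W (Return a' y b) \<and> w \<le> w' \<and> w' \<le> 2 / (\<mu> * \<Delta>) \<and>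
    real (\<Sum>i=n..<n'. q i) \<le> 2 + 3200 * work A Q * (2 * \<Delta> / A + (w' - w) / Q) \<and>
    (b \<longrightarrow> certificate c \<mu> \<Delta>) \<and> (\<not> b \<longrightarrow> decrease_found c \<Delta> a' y w')"
proof -
  define finished where "finished \<longleftrightarrow> (\<exists>n' a' y b w'. n \<le> n' \<and> \<sigma> n' = W (Return a' y b) \<and>
    w \<le> w' \<and> w' \<le> 2 / (\<mu> * \<Delta>) \<and>
    real (\<Sum>i=n..<n'. q i) \<le> 2 + 3200 * work A Q * (2 * \<Delta> / A + (w' - w) / Q) \<and>
    (b \<longrightarrow> certificate c \<mu> \<Delta>) \<and> (\<not> b \<longrightarrow> decrease_found c \<Delta> a' y w'))"
  have finishI: finished if "n \<le> n'" "\<sigma> n' = W (Return a' y b)" "w \<le> w'" "w' \<le> 2 / (\<mu> * \<Delta>)"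
    "real (\<Sum>i=n..<n'. q i) \<le> 2 + 3200 * work A Q * (2 * \<Delta> / A + (w' - w) / Q)"
    "b \<Longrightarrow> certificate c \<mu> \<Delta>" "\<not> b \<Longrightarrow> decrease_found c \<Delta> a' y w'" for n' a' y b w'
    unfolding finished_def using that by blast
  define rad where "rad x = (norm (x - c))\<^sup>2 / \<Delta>\<^sup>2" for x
  define live where "live t \<longleftrightarrow> (\<exists>a ybar ys x. \<sigma> (Suc n + t) = W (Loop a ybar ys) \<and>
    loop_inv c \<Delta> w t a ybar ys x \<and> (t > 0 \<longrightarrow> f c - 4 * \<Delta> / 5 \<le> f ybar \<and> rad x \<le> 2 / (\<mu> * \<Delta>)) \<and>
    (\<Sum>i=n..<Suc n + t. q i) = 2 * t)" for t
  have liveI: "live t" if "\<sigma> (Suc n + t) = W (Loop a ybar ys)" "loop_inv c \<Delta> w t a ybar ys x"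
    "t > 0 \<Longrightarrow> f c - 4 * \<Delta> / 5 \<le> f ybar" "t > 0 \<Longrightarrow> rad x \<le> 2 / (\<mu> * \<Delta>)"
    "(\<Sum>i=n..<Suc n + t. q i) = 2 * t" for t a ybar ys x
    unfolding live_def using that by blast
  have budget: "0 \<le> 3200 * work A Q * (2 * \<Delta> / A + (w' - w) / Q)" if "w \<le> w'" for w'
    using that pos by (intro mult_nonneg_nonneg add_nonneg_nonneg) (auto simp: work_nonneg)
  have first: "finished \<or> live 0"
  proof -
    from step[OF start] obtain s' where s': "\<sigma> (Suc n) = W s'"
      and st: "blci_step X f g c \<mu> \<Delta> m (Entry a) (q n) s'" by auto
    from st show ?thesis
    proof cases
      case empty_level
      have "f c - \<Delta> \<le> f z" if "z \<in> X" for z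
      proof -
        have "f c - \<Delta> < aff a z" using empty_level(3) that by auto
        also have "\<dots> \<le> f z" using a that by (simp add: minorant_def)
        finally show ?thesis by simp
      qed
      then have "certificate c \<mu> \<Delta>" by (simp add: certificate_def)
      moreover have "real (\<Sum>i=n..<Suc n. q i) \<le> 2 + 3200 * work A Q * (2 * \<Delta> / A + (w - w) / Q)"
        using empty_level budget[of w] by simp
      moreover have "\<sigma> (Suc n) = W (Return a c True)" using s' empty_level by simp
      ultimately have finished using w by (intro finishI[of "Suc n" a c True w]) auto
      then show ?thesis ..
    next
      case (initial_point x0)
      have "loop_inv c \<Delta> w 0 a x0 [x0] x0"
        using initial_point a far by (intro loop_inv_init)
      then have "live 0" using s' initial_point by (intro liveI) auto
      then show ?thesis ..
    qed
  qed
  have next_iter: "finished \<or> live (Suc t)" if "live t" for t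
  proof -
    obtain a ybar ys x where \<sigma>: "\<sigma> (Suc n + t) = W (Loop a ybar ys)"
      and inv: "loop_inv c \<Delta> w t a ybar ys x"
      and high: "t > 0 \<Longrightarrow> f c - 4 * \<Delta> / 5 \<le> f ybar" and near: "t > 0 \<Longrightarrow> rad x \<le> 2 / (\<mu> * \<Delta>)"
      and qs: "(\<Sum>i=n..<Suc n + t. q i) = 2 * t"
      using \<open>live t\<close> unfolding live_def by blast
    have props: "ys \<noteq> []" "set ys \<subseteq> X" "minorant a" and wx: "w * \<Delta>\<^sup>2 \<le> (norm (x - c))\<^sup>2"
      using inv by (auto simp: loop_inv_def)
    have w_rad: "w \<le> rad x" using wx pos by (simp add: rad_def field_simps)
    have count: "real t \<le> 1600 * work A Q * (2 * \<Delta> / A + (rad x - w) / Q)"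
      unfolding rad_def by (rule loop_count[OF inv high pos(2-4)])
    from step[OF \<sigma>] obtain s' where s': "\<sigma> (Suc (Suc n + t)) = W s'"
      and st: "blci_step X f g c \<mu> \<Delta> m (Loop a ybar ys) (q (Suc n + t)) s'" by auto
    have total: "real (\<Sum>i=n..<Suc (Suc n + t). q i) = real (2 * t + q (Suc n + t))"
      using qs by simp
    have cost: "real (\<Sum>i=n..<Suc (Suc n + t). q i)
        \<le> 2 + 3200 * work A Q * (2 * \<Delta> / A + (w' - w) / Q)"
      if "q (Suc n + t) \<le> 2" "rad x \<le> w' \<or> t = 0" "w \<le> w'" for w'
    proof (cases "t = 0")
      case True
      have "real (\<Sum>i=n..<Suc (Suc n + t). q i) \<le> 2" using total that True by simp
      with budget[OF that(3)] show ?thesis by linarith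
    next
      case False
      have "1600 * work A Q * (2 * \<Delta> / A + (rad x - w) / Q)
          \<le> 1600 * work A Q * (2 * \<Delta> / A + (w' - w) / Q)"
        using that False pos by (intro mult_left_mono add_left_mono divide_right_mono) (auto simp: work_nonneg)
      then show ?thesis unfolding total using count that(1) by simp
    qed
    show ?thesis using st
    proof cases
      case model_bound
      have "certificate c \<mu> \<Delta>"
        unfolding certificate_def using model_bound_imp_level_bound[OF model_bound(3) props] by blast
      moreover have "real (\<Sum>i=n..<Suc (Suc n + t). q i)
        \<le> 2 + 3200 * work A Q * (2 * \<Delta> / A + (2 / (\<mu> * \<Delta>) - w) / Q)"
        using model_bound near w by (intro cost) auto
      ultimately have "finished"
        using w by (intro finishI[OF _ s'[unfolded model_bound(2)]]) auto
      then show ?thesis ..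
    next
      case (far_away x' a')
      have inv': "loop_inv c \<Delta> w (Suc t) a' (next_ybar ybar ys x') (ys @ [next_y ybar ys x']) x'"
        using loop_inv_step[OF inv far_away(4)] by blast
      have "certificate c \<mu> \<Delta>"
        unfolding certificate_def
      proof (intro disjI2 ballI impI)
        fix z assume z: "z \<in> X" "f z \<le> f c - \<Delta>"
        have "minorant a'" using inv' by (simp add: loop_inv_def)
        then have "aff a' z \<le> f c - \<Delta>" using z by (auto simp: minorant_def intro: order_trans)
        then have "inner (x' - c) (z - x') \<ge> 0" using inv' z by (auto simp: loop_inv_def)
        then have "(norm (x' - c))\<^sup>2 \<le> (norm (z - c))\<^sup>2" by (rule obtuse_imp_closer(2))
        moreover have "2 * \<Delta> / \<mu> \<le> (norm (x' - c))\<^sup>2"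
          using far_away(5) pos by (simp add: field_simps power2_eq_square)
        ultimately show "2 * \<Delta> / \<mu> \<le> (norm (z - c))\<^sup>2" by linarith
      qed
      moreover have "real (\<Sum>i=n..<Suc (Suc n + t). q i)
        \<le> 2 + 3200 * work A Q * (2 * \<Delta> / A + (2 / (\<mu> * \<Delta>) - w) / Q)"
        using far_away near w by (intro cost) auto
      ultimately have "finished"
        using w by (intro finishI[OF _ s'[unfolded far_away(2)]]) auto
      then show ?thesis ..
    next
      case (decrease x' a')
      note inv' = loop_inv_step[OF inv decrease(4)]
      have near': "rad x' \<le> 2 / (\<mu> * \<Delta>)" using decrease(5) by (simp add: rad_def)
      have mono: "rad x \<le> rad x'" using inv'(2) pos by (simp add: rad_def divide_right_mono)
      have "decrease_found c \<Delta> a' (next_ybar ybar ys x') (rad x')"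
        using inv'(1) loop_inv_farther[OF inv'(1) pos(2)] decrease(6)
        by (simp add: decrease_found_def rad_def loop_inv_def)
      moreover have "real (\<Sum>i=n..<Suc (Suc n + t). q i)
        \<le> 2 + 3200 * work A Q * (2 * \<Delta> / A + (rad x' - w) / Q)"
        using decrease mono w_rad by (intro cost) auto
      ultimately have "finished"
        using w_rad mono near' by (intro finishI[OF _ s'[unfolded decrease(2)]]) auto
      then show ?thesis ..
    next
      case (iterate x' a')
      note inv' = loop_inv_step[OF inv iterate(4)]
      have "live (Suc t)"
        using s' iterate inv'(1) qs by (intro liveI) (auto simp: rad_def)
      then show ?thesis ..
    qed
  qed
  \<comment> \<open>The bound of \<open>loop_count\<close> excludes a call that never returns.\<close>
  have "finished"
  proof (rule ccontr)
    assume nd: "\<not> finished"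
    have live: "live t" for t
      by (induction t) (use nd first next_iter in auto)
    define B where "B = 1600 * work A Q * (2 * \<Delta> / A + (2 / (\<mu> * \<Delta>) - w) / Q)"
    obtain t where t: "real t > max B 0" using reals_Archimedean2 by blast
    then have "t > 0" by auto
    with live[of t] obtain a ybar ys x where inv: "loop_inv c \<Delta> w t a ybar ys x"
      and high: "f c - 4 * \<Delta> / 5 \<le> f ybar" and near: "rad x \<le> 2 / (\<mu> * \<Delta>)"
      unfolding live_def by blast
    have "real t \<le> 1600 * work A Q * (2 * \<Delta> / A + (rad x - w) / Q)"
      unfolding rad_def by (rule loop_count[OF inv high pos(2-4)])
    also have "\<dots> \<le> B"
      unfolding B_def using near pos
      by (intro mult_left_mono add_left_mono divide_right_mono) (auto simp: work_nonneg)
    finally show False using t by simp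
  qed
  then show ?thesis unfolding finished_def .
qed

end

section \<open>Quadratic growth and the optimality gap\<close>

locale blw_problem = smooth_convex X f g \<rho> M m
  for X :: "'a::real_inner set" and f g \<rho> M m +
  fixes xbar0 :: 'a and \<mu>s fs :: real and Xs :: "'a set" and \<sigma> :: "nat \<Rightarrow> 'a blw_state" and q :: "nat \<Rightarrow> nat"
  assumes Xs: "Xs \<subseteq> X" "Xs \<noteq> {}" "p \<in> Xs \<Longrightarrow> f p = fs" and fs_le: "x \<in> X \<Longrightarrow> fs \<le> f x"
    and xbar0: "xbar0 \<in> X" and mus: "\<mu>s > 0"
    and growth: "x \<in> X \<Longrightarrow> f x \<le> f xbar0 \<Longrightarrow> \<mu>s / 2 * (infdist x Xs)\<^sup>2 \<le> f x - fs"
    and run: "blw_step X f g m (\<sigma> n) (q n) (\<sigma> (Suc n))"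
begin

lemma infdist_ge:
  assumes "\<And>p. p \<in> Xs \<Longrightarrow> d \<le> norm (x - p)"
  shows "d \<le> infdist x Xs"
  using Xs(2) assms by (auto simp: infdist_def dist_norm intro: cINF_greatest)

lemma infdist_mono:
  assumes "\<And>p. p \<in> Xs \<Longrightarrow> norm (x - p) \<le> norm (y - p)"
  shows "infdist x Xs \<le> infdist y Xs"
proof (rule infdist_ge)
  fix p assume p: "p \<in> Xs"
  have "infdist x Xs \<le> norm (x - p)" using infdist_le[OF p, of x] by (simp add: dist_norm)
  also have "\<dots> \<le> norm (y - p)" by (rule assms[OF p])
  finally show "infdist x Xs \<le> norm (y - p)" .
qed

text \<open>
  Suppose that the gap \<open>G\<close> exceeds \<open>\<Delta>\<close>. On the segment from \<open>c\<close> to a minimizer \<open>p\<close>, convexity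
  reaches the level \<open>f c - \<Delta>\<close> after the fraction \<open>\<Delta> / G\<close>, and the certificate bounds the length of
  this piece from below. So \<open>\<parallel>c - p\<parallel>\<close> is at least \<open>G / \<Delta>\<close> times \<open>sqrt (2 * \<Delta> / \<mu>)\<close>, and
  quadratic growth bounds \<open>G\<close>.
\<close>

lemma gap_le:
  assumes c: "c \<in> X" "f c \<le> f xbar0" and pos: "\<mu> > 0" "\<Delta> > 0" and cert: "certificate c \<mu> \<Delta>"
  shows "f c - fs \<le> \<Delta> \<or> f c - fs \<le> \<mu> * \<Delta> / \<mu>s"
proof (rule disjCI)
  define G where "G = f c - fs"
  assume "\<not> f c - fs \<le> \<mu> * \<Delta> / \<mu>s"
  then have big: "\<mu> * \<Delta> / \<mu>s < G" by (simp add: G_def)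
  show "f c - fs \<le> \<Delta>"
  proof (rule ccontr)
    assume "\<not> f c - fs \<le> \<Delta>"
    then have G: "\<Delta> < G" by (simp add: G_def)
    have "\<not> (\<forall>z\<in>X. f c - \<Delta> \<le> f z)" using G Xs unfolding G_def by fastforce
    then have far: "2 * \<Delta> / \<mu> \<le> (norm (z - c))\<^sup>2" if "z \<in> X" "f z \<le> f c - \<Delta>" for z
      using cert that unfolding certificate_def by blast
    have "sqrt (2 * G\<^sup>2 / (\<mu> * \<Delta>)) \<le> infdist c Xs"
    proof (rule infdist_ge)
      fix p assume p: "p \<in> Xs"
      define u where "u = \<Delta> / G"
      have u: "0 < u" "u \<le> 1" using G pos by (auto simp: u_def)
      define z where "z = (1 - u) *\<^sub>R c + u *\<^sub>R p"
      have z: "z \<in> X" unfolding z_def using convex_X c p Xs u by (intro convexD_alt) auto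
      have "f z \<le> (1 - u) * f c + u * f p"
        unfolding z_def using c p Xs u by (intro convex_onD[OF convex_f]) auto
      also have "\<dots> = f c - \<Delta>"
      proof -
        have "u * G = \<Delta>" using G pos by (simp add: u_def)
        then show ?thesis using Xs(3)[OF p] by (simp add: G_def algebra_simps)
      qed
      finally have "2 * \<Delta> / \<mu> \<le> (norm (z - c))\<^sup>2" using far z by blast
      also have "z - c = u *\<^sub>R (p - c)" by (simp add: z_def algebra_simps)
      also have "(norm \<dots>)\<^sup>2 = u\<^sup>2 * (norm (c - p))\<^sup>2"
        using u by (simp add: power_mult_distrib norm_minus_commute)
      finally have "2 * G\<^sup>2 / (\<mu> * \<Delta>) \<le> (norm (c - p))\<^sup>2"
        using G pos by (simp add: u_def field_simps power2_eq_square)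
      then show "sqrt (2 * G\<^sup>2 / (\<mu> * \<Delta>)) \<le> norm (c - p)" by (rule real_le_lsqrt[rotated -1]) simp_all
    qed
    then have "(sqrt (2 * G\<^sup>2 / (\<mu> * \<Delta>)))\<^sup>2 \<le> (infdist c Xs)\<^sup>2"
      using pos by (intro power_mono) auto
    then have "\<mu>s / 2 * (2 * G\<^sup>2 / (\<mu> * \<Delta>)) \<le> \<mu>s / 2 * (infdist c Xs)\<^sup>2"
      using pos mus by (intro mult_left_mono) auto
    also have "\<dots> \<le> G" using growth c by (simp add: G_def)
    finally have "\<mu>s * G\<^sup>2 \<le> G * (\<mu> * \<Delta>)" using pos by (simp add: field_simps)
    then have "\<mu>s * G \<le> \<mu> * \<Delta>" using G pos by (simp add: power2_eq_square mult.left_commute)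
    then show False using big mus by (simp add: field_simps)
  qed
qed

text \<open>
  The subgradient inequality gives \<open>G \<le> \<parallel>g xbar0\<parallel> * infdist xbar0 Xs\<close>, and quadratic growth bounds the
  distance in terms of the gap \<open>G\<close>.
\<close>

lemma initial_gap:
  assumes "g xbar0 \<noteq> 0"
  shows "f xbar0 - fs \<le> 2 * (norm (g xbar0))\<^sup>2 / \<mu>s"
proof -
  define N where "N = norm (g xbar0)"
  define G where "G = f xbar0 - fs"
  have N: "N > 0" using assms by (simp add: N_def)
  have "G / N \<le> infdist xbar0 Xs"
  proof (rule infdist_ge)
    fix p assume p: "p \<in> Xs"
    have "G \<le> - inner (g xbar0) (p - xbar0)"
      using subgrad[OF xbar0, of p] Xs p by (auto simp: G_def)
    also have "\<dots> \<le> N * norm (xbar0 - p)"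
      using Cauchy_Schwarz_ineq2[of "g xbar0" "p - xbar0"]
      by (simp add: N_def norm_minus_commute abs_le_iff)
    finally show "G / N \<le> norm (xbar0 - p)" using N by (simp add: field_simps)
  qed
  moreover have "G \<ge> 0" using fs_le xbar0 by (simp add: G_def)
  ultimately have "(G / N)\<^sup>2 \<le> (infdist xbar0 Xs)\<^sup>2" using N by (intro power_mono) auto
  then have "\<mu>s / 2 * (G / N)\<^sup>2 \<le> \<mu>s / 2 * (infdist xbar0 Xs)\<^sup>2" using mus by (intro mult_left_mono) auto
  also have "\<dots> \<le> G" using growth[OF xbar0] by (simp add: G_def)
  finally have le: "\<mu>s * G * G \<le> 2 * N\<^sup>2 * G" using N by (simp add: field_simps power2_eq_square)
  have "\<mu>s * G \<le> 2 * N\<^sup>2"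
  proof (cases "G = 0")
    case False
    then show ?thesis using le \<open>G \<ge> 0\<close> by (simp add: mult_le_cancel_right)
  qed simp
  then show ?thesis using mus by (simp add: G_def N_def field_simps)
qed

section \<open>The halving loop\<close>

lemma run_First:
  assumes "\<sigma> i = First k c \<mu> \<Delta> s" "\<forall>a y b. s \<noteq> Return a y b"
  shows "\<exists>s'. \<sigma> (Suc i) = First k c \<mu> \<Delta> s' \<and> blci_step X f g c \<mu> \<Delta> m s (q i) s'"
  using run[of i] unfolding assms(1) by cases (use assms(2) in blast)+

lemma run_Second:
  assumes "\<sigma> i = Second k c \<mu> \<Delta> s" "\<forall>a y b. s \<noteq> Return a y b"
  shows "\<exists>s'. \<sigma> (Suc i) = Second k c \<mu> \<Delta> s' \<and> blci_step X f g c \<mu> (4 * \<Delta> / 5) m s (q i) s'"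
  using run[of i] unfolding assms(1) by cases (use assms(2) in blast)+

lemma run_Halving:
  assumes "\<sigma> i = Halving k c \<mu> \<Delta> s" "\<forall>a y b. s \<noteq> Return a y b"
  shows "\<exists>s'. \<sigma> (Suc i) = Halving k c \<mu> \<Delta> s' \<and> blci_step X f g c \<mu> \<Delta> m s (q i) s'"
  using run[of i] unfolding assms(1) by cases (use assms(2) in blast)+

lemma run_return:
  "\<sigma> i = First k c \<mu> \<Delta> (Return a y True) \<Longrightarrow> q i = 0 \<and> \<sigma> (Suc i) = Completed k c \<mu> \<Delta>"
  "\<sigma> i = First k c \<mu> \<Delta> (Return a y False) \<Longrightarrow> q i = 0 \<and> \<sigma> (Suc i) = Second k c \<mu> \<Delta> (Entry a)"
  "\<sigma> i = Second k c \<mu> \<Delta> (Return a y True) \<Longrightarrow> q i = 0 \<and> \<sigma> (Suc i) = Completed k c \<mu> \<Delta>"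
  "\<sigma> i = Second k c \<mu> \<Delta> (Return a y False) \<Longrightarrow>
    q i = 0 \<and> \<sigma> (Suc i) = Halving k y \<mu> \<Delta> (Entry (lin f g y))"
  "\<sigma> i = Halving k c \<mu> \<Delta> (Return a y True) \<Longrightarrow> q i = 0 \<and> \<sigma> (Suc i) = Completed k c \<mu> \<Delta>"
  "\<sigma> i = Halving k c \<mu> \<Delta> (Return a y False) \<Longrightarrow>
    q i = 0 \<and> \<sigma> (Suc i) = Halving k c (\<mu> / 2) (2 * \<Delta>) (Entry a)"
  "\<sigma> i = Completed k c \<mu> \<Delta> \<Longrightarrow>
    q i = 0 \<and> \<sigma> (Suc i) = First (Suc k) c \<mu> (3 / 4 * \<Delta>) (Entry (lin f g c))"
  using run[of i] by (auto elim: blw_step.cases blci_step.cases)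

lemma sum_upto_Suc:
  assumes "n \<le> n'" "n' < n''" "q n' = 0"
  shows "real (\<Sum>i=n..<n''. q i) = real (\<Sum>i=n..<n'. q i) + real (\<Sum>i=Suc n'..<n''. q i)"
proof -
  have "(\<Sum>i=n..<n''. q i) = (\<Sum>i=n..<n'. q i) + (\<Sum>i=n'..<n''. q i)"
    using assms by (simp add: sum.atLeastLessThan_concat)
  also have "(\<Sum>i=n'..<n''. q i) = q n' + (\<Sum>i=Suc n'..<n''. q i)"
    using assms by (simp add: sum.atLeast_Suc_lessThan)
  finally show ?thesis using assms by simp
qed

text \<open>
  A further halving needs a point more than \<open>4 * \<Delta> / 5\<close> below the center. If the gap is at most
  \<open>7/10 * \<Delta>\<close>, there is none; otherwise the gap is at most \<open>4/3 * P / \<mu>s\<close>, and then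
  \<open>\<mu> = P / \<Delta>\<close> still exceeds \<open>3/5 * \<mu>s\<close>, so the halved value stays above \<open>\<mu>s / 4\<close>. In the cost, the
  calls contribute \<open>2 * \<Delta> + 4 * \<Delta> + ... + 2 * \<Delta>' = 4 * \<Delta>' - 2 * \<Delta>\<close> and the telescoping sum of the distance
  increments. The constants \<open>2\<close> of the calls that cause a halving are the term \<open>2 * log 2 (\<mu> / \<mu>')\<close>.
\<close>

lemma halving_terminates:
  assumes "\<sigma> n = Halving k c \<mu> \<Delta> (Entry a)" "minorant a" "farther c \<Delta> a w" "w \<le> 2 / P"
    and "\<mu> * \<Delta> = P" "\<mu>s / 4 \<le> \<mu>" "\<mu> \<le> 2 ^ r * (\<mu>s / 4)"
    and "f c - fs \<le> 4 / 3 * P / \<mu>s \<or> f c - fs \<le> 7 / 10 * \<Delta>"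
    and "c \<in> X" "f c \<le> f xbar0" "P > 0" "A > 0" "Q > 0"
  shows "\<exists>n' \<mu>' \<Delta>'. n < n' \<and> \<sigma> n' = Completed k c \<mu>' \<Delta>' \<and> \<mu>' * \<Delta>' = P \<and> \<mu>s / 4 \<le> \<mu>' \<and> \<mu>' \<le> \<mu> \<and>
    (f c - fs \<le> \<Delta>' \<or> f c - fs \<le> P / \<mu>s) \<and>
    real (\<Sum>i=n..<n'. q i) \<le> 2 + 2 * log 2 (\<mu> / \<mu>') +
      3200 * work A Q * ((4 * \<Delta>' - 2 * \<Delta>) / A + (2 / P - w) / Q)"
  using assms
proof (induction r arbitrary: n \<mu> \<Delta> a w rule: less_induct)
  case (less r n \<mu> \<Delta> a w)
  note c = \<open>c \<in> X\<close> \<open>f c \<le> f xbar0\<close> and pos = \<open>P > 0\<close> \<open>A > 0\<close> \<open>Q > 0\<close>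
  have \<mu>: "\<mu> > 0" using less.prems(6) mus by linarith
  have \<Delta>: "\<Delta> > 0" using less.prems(5) \<mu> pos by (metis zero_less_mult_pos)
  have w_le: "w \<le> 2 / (\<mu> * \<Delta>)" using less.prems(4,5) by simp
  obtain n1 a' y b w' where n1: "n \<le> n1" and ret: "\<sigma> n1 = Halving k c \<mu> \<Delta> (Return a' y b)"
    and w': "w \<le> w'" "w' \<le> 2 / P"
    and cost: "real (\<Sum>i=n..<n1. q i) \<le> 2 + 3200 * work A Q * (2 * \<Delta> / A + (w' - w) / Q)"
    and true: "b \<Longrightarrow> certificate c \<mu> \<Delta>" and false: "\<not> b \<Longrightarrow> decrease_found c \<Delta> a' y w'"
    using blci_call_returns[where \<sigma>=\<sigma> and W="Halving k c \<mu> \<Delta>" and q=q, OF run_Halving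
        less.prems(1) c(1) less.prems(2,3) w_le \<mu> \<Delta> pos(2,3)] less.prems(5)
    by blast
  show ?case
  proof (cases b)
    case True
    have next_state: "q n1 = 0" "\<sigma> (Suc n1) = Completed k c \<mu> \<Delta>"
      using run_return(5) ret True by auto
    have "3200 * work A Q * (2 * \<Delta> / A + (w' - w) / Q)
        \<le> 3200 * work A Q * ((4 * \<Delta> - 2 * \<Delta>) / A + (2 / P - w) / Q)"
      using w' pos by (intro mult_left_mono add_mono divide_right_mono) (auto simp: work_nonneg)
    then have "real (\<Sum>i=n..<Suc n1. q i) \<le> 2 + 2 * log 2 (\<mu> / \<mu>) +
        3200 * work A Q * ((4 * \<Delta> - 2 * \<Delta>) / A + (2 / P - w) / Q)"
      using cost next_state(1) n1 \<mu> by simp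
    moreover have "f c - fs \<le> \<Delta> \<or> f c - fs \<le> P / \<mu>s"
      using gap_le[OF c \<mu> \<Delta> true[OF True]] less.prems(5) by simp
    ultimately show ?thesis
      using next_state(2) n1 less.prems(5,6)
      by (intro exI[of _ "Suc n1"] exI[of _ \<mu>] exI[of _ \<Delta>]) auto
  next
    case False
    note dec = false[OF False]
    have next_state: "q n1 = 0" "\<sigma> (Suc n1) = Halving k c (\<mu> / 2) (2 * \<Delta>) (Entry a')"
      using run_return(6) ret False by auto
    have gap: "4 * \<Delta> / 5 < f c - fs"
      using dec fs_le[of y] by (simp add: decrease_found_def)
    then have "4 * \<Delta> / 5 < 4 / 3 * P / \<mu>s" using less.prems(8) \<Delta> by linarith
    then have "4 * \<Delta> / 5 * \<mu>s < 4 / 3 * (\<mu> * \<Delta>)"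
      using mus less.prems(5) by (simp add: field_simps)
    then have "\<Delta> * (3 * \<mu>s) < \<Delta> * (5 * \<mu>)" by (simp add: algebra_simps)
    then have low: "3 * \<mu>s < 5 * \<mu>" using \<Delta> by simp
    have r: "r > 0"
    proof (rule ccontr)
      assume "\<not> r > 0"
      then have "\<mu> \<le> \<mu>s / 4" using less.prems(7) by simp
      then show False using low mus by linarith
    qed
    then have pow: "(2::real) ^ r = 2 * 2 ^ (r - 1)" by (cases r) auto
    have "\<mu> \<le> 2 * (2 ^ (r - 1) * (\<mu>s / 4))" using less.prems(7) by (simp only: pow mult.assoc)
    then have half: "\<mu> / 2 \<le> 2 ^ (r - 1) * (\<mu>s / 4)" by linarith
    have "minorant a'" "farther c \<Delta> a' w'" using dec by (auto simp: decrease_found_def)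
    then have dbl: "minorant a'" "farther c (2 * \<Delta>) a' w'" using farther_double c(1) by auto
    obtain n2 \<mu>' \<Delta>' where n2: "Suc n1 < n2" "\<sigma> n2 = Completed k c \<mu>' \<Delta>'" "\<mu>' * \<Delta>' = P"
        "\<mu>s / 4 \<le> \<mu>'" "\<mu>' \<le> \<mu> / 2" "f c - fs \<le> \<Delta>' \<or> f c - fs \<le> P / \<mu>s"
      and cost2: "real (\<Sum>i=Suc n1..<n2. q i) \<le> 2 + 2 * log 2 (\<mu> / 2 / \<mu>') +
        3200 * work A Q * ((4 * \<Delta>' - 2 * (2 * \<Delta>)) / A + (2 / P - w') / Q)"
      using less.IH[of "r - 1", OF _ next_state(2) dbl w'(2) _ _ half _ c pos] r low mus
        less.prems(5,8) \<Delta> by (auto simp: field_simps)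
    have log_eq: "log 2 (\<mu> / \<mu>') = 1 + log 2 (\<mu> / 2 / \<mu>')"
    proof -
      have "log 2 (\<mu> / \<mu>') = log 2 (2 * (\<mu> / 2 / \<mu>'))" by simp
      also have "\<dots> = 1 + log 2 (\<mu> / 2 / \<mu>')"
        using \<mu> n2(4) mus by (subst log_mult) auto
      finally show ?thesis .
    qed
    have "3200 * work A Q * (2 * \<Delta> / A + (w' - w) / Q) +
        3200 * work A Q * ((4 * \<Delta>' - 2 * (2 * \<Delta>)) / A + (2 / P - w') / Q) =
        3200 * work A Q * ((4 * \<Delta>' - 2 * \<Delta>) / A + (2 / P - w) / Q)"
      by (simp add: distrib_left[symmetric] add_divide_distrib diff_divide_distrib)
    then have "real (\<Sum>i=n..<n2. q i) \<le> 2 + 2 * log 2 (\<mu> / \<mu>') +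
        3200 * work A Q * ((4 * \<Delta>' - 2 * \<Delta>) / A + (2 / P - w) / Q)"
      using cost cost2 sum_upto_Suc[OF n1 Suc_lessD[OF n2(1)] next_state(1)] log_eq by linarith
    then show ?thesis
      using n1 n2 \<mu> by (intro exI[of _ n2] exI[of _ \<mu>'] exI[of _ \<Delta>']) auto
  qed
qed

section \<open>One outer iteration\<close>

definition outer_inv :: "real \<Rightarrow> 'a \<Rightarrow> real \<Rightarrow> real \<Rightarrow> bool"
  where "outer_inv P c \<mu> \<Delta> \<longleftrightarrow> c \<in> X \<and> f c \<le> f xbar0 \<and> \<mu> * \<Delta> = P \<and> \<mu>s / 4 \<le> \<mu> \<and>
    (f c - fs \<le> \<Delta> \<or> f c - fs \<le> P / \<mu>s)"

text \<open>
  During an outer iteration with \<open>\<mu> * \<Delta> = P\<close>, the lower bound \<open>\<mu>s / 4\<close> for \<open>\<mu>\<close> gives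
  \<open>\<Delta> \<le> 4 * P / \<mu>s\<close>, and \<open>2 / (\<mu> * \<Delta>)\<close>, the value of the normalized squared distance
  that ends a call, is \<open>2 / P\<close> (\<open>5/4\<close> of it in the second call, which uses \<open>4 * \<Delta> / 5\<close>).
\<close>

definition outer_work :: "real \<Rightarrow> real"
  where "outer_work P = work (4 * P / \<mu>s) (2 / P)"

text \<open>
  The first call, the second call and the last halving call contribute the constant \<open>6\<close>. Their work
  is at most \<open>3\<close>, \<open>3\<close> and, for the whole halving loop, \<open>5\<close> times \<open>3200 * outer_work\<close>. If both
  first calls find a decrease, a gap of at most \<open>4/3 * D\<close> falls to at most
  \<open>(4/3 - 16/25) * D \<le> 7/10 * D\<close>, one of the two alternatives in \<open>halving_terminates\<close>.
\<close>

lemma outer_iteration: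
  assumes "\<sigma> n = Completed k c \<mu> \<Delta>" and inv: "outer_inv P c \<mu> \<Delta>" and "P > 0"
  shows "\<exists>n' c' \<mu>' \<Delta>'. \<sigma> n' = Completed (Suc k) c' \<mu>' \<Delta>' \<and> outer_inv (3 / 4 * P) c' \<mu>' \<Delta>' \<and> n < n' \<and>
    infdist c' Xs \<le> infdist c Xs \<and>
    real (\<Sum>i=n..<n'. q i) \<le> 6 + 2 * log 2 (\<mu> / \<mu>') + 35200 * outer_work (3 / 4 * P)"
proof -
  define P' where "P' = 3 / 4 * P"
  define D where "D = 3 / 4 * \<Delta>"
  define A where "A = 4 * P' / \<mu>s"
  define Q where "Q = 2 / P'"
  define B where "B = 3200 * work A Q"
  have B: "B \<ge> 0" by (simp add: B_def work_nonneg)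
  have P': "P' > 0" using \<open>P > 0\<close> by (simp add: P'_def)
  have AQ: "A > 0" "Q > 0" using P' mus by (simp_all add: A_def Q_def)
  have c: "c \<in> X" "f c \<le> f xbar0" and \<mu>\<Delta>: "\<mu> * \<Delta> = P" and low: "\<mu>s / 4 \<le> \<mu>"
    and gap: "f c - fs \<le> \<Delta> \<or> f c - fs \<le> P / \<mu>s"
    using inv by (auto simp: outer_inv_def)
  have \<mu>: "\<mu> > 0" using low mus by linarith
  have \<mu>D: "\<mu> * D = P'" using \<mu>\<Delta> by (simp add: D_def P'_def)
  have D: "D > 0" using \<mu>D \<mu> P' by (metis zero_less_mult_pos)
  have le_A: "\<delta> \<le> A" if "\<nu> * \<delta> = P'" "\<mu>s / 4 \<le> \<nu>" for \<nu> \<delta>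
  proof -
    have "\<nu> > 0" using that(2) mus by linarith
    then have "\<delta> > 0" using that(1) P' by (metis zero_less_mult_pos)
    then have "\<mu>s / 4 * \<delta> \<le> P'" unfolding that(1)[symmetric] using that(2) by (intro mult_right_mono) auto
    then show ?thesis using mus by (simp add: A_def field_simps)
  qed
  have cost_le: "B * u \<le> B * v" if "u \<le> v" for u v using that B by (rule mult_left_mono)
  have budget: "35200 * outer_work (3 / 4 * P) = B * 11"
    by (simp add: outer_work_def B_def A_def Q_def P'_def)
  have P_le: "f c - fs \<le> 4 / 3 * D \<or> f c - fs \<le> 4 / 3 * P' / \<mu>s"
    using gap by (simp add: D_def P'_def)
  have start: "q n = 0" "\<sigma> (Suc n) = First (Suc k) c \<mu> D (Entry (lin f g c))"
    using run_return(7)[OF assms(1)] by (auto simp: D_def)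
  have far0: "farther c' \<delta> a 0" for c' \<delta> a by (simp add: farther_def)
  have w0: "0 \<le> 2 / (\<mu> * D)" using \<mu> D by simp
  obtain n1 a1 y1 b1 w1 where n1: "Suc n \<le> n1"
    and ret1: "\<sigma> n1 = First (Suc k) c \<mu> D (Return a1 y1 b1)"
    and w1: "w1 \<le> 2 / (\<mu> * D)"
    and cost1: "real (\<Sum>i=Suc n..<n1. q i) \<le> 2 + B * (2 * D / A + (w1 - 0) / Q)"
    and true1: "b1 \<Longrightarrow> certificate c \<mu> D" and false1: "\<not> b1 \<Longrightarrow> decrease_found c D a1 y1 w1"
    using blci_call_returns[where \<sigma>=\<sigma> and W="First (Suc k) c \<mu> D" and q=q, OF run_First
        start(2) c(1) minorant_lin[OF c(1)] far0 w0 \<mu> D AQ, folded B_def] by blast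
  have cost1': "real (\<Sum>i=n..<n1. q i) \<le> 2 + B * 3"
  proof -
    have "2 * D / A \<le> 2" using le_A[OF \<mu>D low] AQ by (simp add: field_simps)
    moreover have "w1 / Q \<le> 1" using w1[unfolded \<mu>D] P' by (simp add: Q_def field_simps)
    ultimately have "B * (2 * D / A + (w1 - 0) / Q) \<le> B * 3" by (intro cost_le) simp
    moreover have "(\<Sum>i=n..<n1. q i) = (\<Sum>i=Suc n..<n1. q i)"
      using n1 start(1) by (simp add: sum.atLeast_Suc_lessThan)
    ultimately show ?thesis using cost1 by linarith
  qed
  \<comment> \<open>The outcome when one of the first two calls returns True: the center does not move.\<close>
  have stay: ?thesis if "n < n'" "\<sigma> n' = Completed (Suc k) c \<mu> D" "f c - fs \<le> D \<or> f c - fs \<le> P' / \<mu>s"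
    "real (\<Sum>i=n..<n'. q i) \<le> 6 + B * 11" for n'
    unfolding budget
    using that c \<mu>D low \<mu>
    by (intro exI[of _ n'] exI[of _ c] exI[of _ \<mu>] exI[of _ D]) (simp add: outer_inv_def P'_def)
  show ?thesis
  proof (cases b1)
    case True
    then have next1: "q n1 = 0" "\<sigma> (Suc n1) = Completed (Suc k) c \<mu> D"
      using run_return(1) ret1 by auto
    show ?thesis
    proof (rule stay)
      show "n < Suc n1" using n1 by simp
      show "f c - fs \<le> D \<or> f c - fs \<le> P' / \<mu>s"
        using gap_le[OF c \<mu> D true1[OF True]] by (simp add: \<mu>D)
      show "real (\<Sum>i=n..<Suc n1. q i) \<le> 6 + B * 11"
        using cost1' next1(1) n1 B by simp
    qed (rule next1(2))
  next
    case False
    then have next1: "q n1 = 0" "\<sigma> (Suc n1) = Second (Suc k) c \<mu> D (Entry a1)"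
      using run_return(2) ret1 by auto
    have dec1: "minorant a1" "y1 \<in> X" "f y1 < f c - 4 * D / 5"
      using false1[OF False] by (auto simp: decrease_found_def)
    define E where "E = 4 * D / 5"
    have E: "E > 0" using D by (simp add: E_def)
    have wE: "0 \<le> 2 / (\<mu> * E)" using \<mu> E by simp
    obtain n2 a2 z b2 w2 where n2: "Suc n1 \<le> n2"
      and ret2: "\<sigma> n2 = Second (Suc k) c \<mu> D (Return a2 z b2)"
      and w2: "w2 \<le> 2 / (\<mu> * E)"
      and cost2: "real (\<Sum>i=Suc n1..<n2. q i) \<le> 2 + B * (2 * E / A + (w2 - 0) / Q)"
      and true2: "b2 \<Longrightarrow> certificate c \<mu> E" and false2: "\<not> b2 \<Longrightarrow> decrease_found c E a2 z w2"
      using blci_call_returns[where \<sigma>=\<sigma> and W="Second (Suc k) c \<mu> D" and q=q,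
          OF run_Second[of _ _ _ _ D, folded E_def] next1(2) c(1) dec1(1) far0 wE \<mu> E AQ,
          folded B_def] by blast
    have cost2': "real (\<Sum>i=n..<n2. q i) \<le> 4 + B * 6"
    proof -
      have "2 * E / A \<le> 2 * (4 / 5)" using le_A[OF \<mu>D low] AQ by (simp add: E_def field_simps)
      moreover have "2 / (\<mu> * E) = 5 / 4 * Q"
        using \<mu>D by (simp add: E_def Q_def mult.commute mult.left_commute)
      then have "w2 / Q \<le> 5 / 4" using w2 AQ by (simp add: field_simps)
      ultimately have "B * (2 * E / A + (w2 - 0) / Q) \<le> B * 3" by (intro cost_le) simp
      moreover have "real (\<Sum>i=n..<n2. q i) = real (\<Sum>i=n..<n1. q i) + real (\<Sum>i=Suc n1..<n2. q i)"
        using n1 n2 next1(1) by (intro sum_upto_Suc) auto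
      ultimately show ?thesis using cost1' cost2 by linarith
    qed
    show ?thesis
    proof (cases b2)
      case True
      then have next2: "q n2 = 0" "\<sigma> (Suc n2) = Completed (Suc k) c \<mu> D"
        using run_return(3) ret2 by auto
      show ?thesis
      proof (rule stay)
        show "n < Suc n2" using n1 n2 by simp
        have "f c - fs \<le> E \<or> f c - fs \<le> \<mu> * E / \<mu>s"
          using gap_le[OF c \<mu> E true2[OF True]] .
        moreover have "E \<le> D" "\<mu> * E / \<mu>s \<le> P' / \<mu>s"
          using D \<mu> mus P' by (auto simp: E_def \<mu>D[symmetric] field_simps)
        ultimately show "f c - fs \<le> D \<or> f c - fs \<le> P' / \<mu>s" by linarith
        show "real (\<Sum>i=n..<Suc n2. q i) \<le> 6 + B * 11"
          using cost2' next2(1) n1 n2 B by simp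
      qed (rule next2(2))
    next
      case False
      then have next2: "q n2 = 0" "\<sigma> (Suc n2) = Halving (Suc k) z \<mu> D (Entry (lin f g z))"
        using run_return(4) ret2 by auto
      have z: "z \<in> X" "f z < f c - 4 * E / 5"
        and closer: "\<And>p. p \<in> X \<Longrightarrow> f p \<le> f c - E \<Longrightarrow> norm (z - p) \<le> norm (c - p)"
        using false2[OF False] by (auto simp: decrease_found_def)
      have fejer: "infdist z Xs \<le> infdist c Xs"
      proof (rule infdist_mono)
        fix p assume p: "p \<in> Xs"
        \<comment> \<open>The point \<open>y1\<close> of the first call shows that minimizers lie below the level of the second.\<close>
        then have "f p \<le> f y1" using Xs(3) fs_le dec1(2) by simp
        then show "norm (z - p) \<le> norm (c - p)" using closer p Xs(1) dec1(3) by (auto simp: E_def)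
      qed
      have fz: "f z \<le> f xbar0" using z c E by linarith
      have gap_z: "f z - fs \<le> 4 / 3 * P' / \<mu>s \<or> f z - fs \<le> 7 / 10 * D"
        using P_le z(2) D unfolding E_def by linarith
      obtain r where "4 * \<mu> / \<mu>s < 2 ^ r" using real_arch_pow[of 2 "4 * \<mu> / \<mu>s"] by auto
      then have r: "\<mu> \<le> 2 ^ r * (\<mu>s / 4)" using mus by (simp add: field_simps)
      have wP: "0 \<le> 2 / P'" using P' by simp
      obtain n3 \<mu>' \<Delta>' where n3: "Suc n2 < n3" "\<sigma> n3 = Completed (Suc k) z \<mu>' \<Delta>'" "\<mu>' * \<Delta>' = P'"
          "\<mu>s / 4 \<le> \<mu>'" "\<mu>' \<le> \<mu>" "f z - fs \<le> \<Delta>' \<or> f z - fs \<le> P' / \<mu>s"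
        and cost3: "real (\<Sum>i=Suc n2..<n3. q i) \<le> 2 + 2 * log 2 (\<mu> / \<mu>') +
          B * ((4 * \<Delta>' - 2 * D) / A + (2 / P' - 0) / Q)"
        using halving_terminates[OF next2(2) minorant_lin[OF z(1)] far0 wP \<mu>D low r gap_z z(1) fz P' AQ]
        unfolding B_def[symmetric] by blast
      have "(4 * \<Delta>' - 2 * D) / A \<le> 4" using le_A[OF n3(3,4)] AQ D by (simp add: field_simps)
      moreover have "(2 / P' - 0) / Q = 1" using P' by (simp add: Q_def)
      ultimately have "B * ((4 * \<Delta>' - 2 * D) / A + (2 / P' - 0) / Q) \<le> B * 5"
        by (intro cost_le) linarith
      moreover have "real (\<Sum>i=n..<n3. q i) = real (\<Sum>i=n..<n2. q i) + real (\<Sum>i=Suc n2..<n3. q i)"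
        using n1 n2 n3(1) next2(1) by (intro sum_upto_Suc) auto
      ultimately have "real (\<Sum>i=n..<n3. q i) \<le> 6 + 2 * log 2 (\<mu> / \<mu>') + B * 11"
        using cost2' cost3 by linarith
      then show ?thesis
        unfolding budget using n1 n2 n3 z fz fejer
        by (intro exI[of _ n3] exI[of _ z] exI[of _ \<mu>'] exI[of _ \<Delta>']) (simp add: outer_inv_def P'_def)
    qed
  qed
qed

end

section \<open>Summation over the outer iterations\<close>

text \<open>
  The ratio satisfies \<open>\<theta> \<le> (3/4) powr ((1 - \<rho>) / 4) \<le> exp (- (1 - \<rho>) / 16)\<close>, since
  \<open>ln (3/4) \<le> - 1/4\<close>; hence \<open>1 / (1 - \<theta>)\<close> is of order \<open>1 / (1 - \<rho>)\<close>.
\<close>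

lemma geometric_sum_le:
  fixes \<rho> :: real
  assumes rho: "0 \<le> \<rho>" "\<rho> \<le> 1"
  defines "\<theta> \<equiv> (3 / 4) powr ((1 - \<rho>) / (1 + 3 * \<rho>))"
  shows "(\<Sum>n<S. \<theta> ^ n) \<le> 17 * (if \<rho> = 1 then real S else min (1 / (1 - \<rho>)) (real S))"
proof -
  have pos: "\<theta> > 0" and le1: "\<theta> \<le> 1" using rho by (auto simp: \<theta>_def intro: powr_le1)
  have "(\<Sum>n<S. \<theta> ^ n) \<le> (\<Sum>n<S. 1)"
    using pos le1 by (intro sum_mono power_le_one) auto
  then have le_S: "(\<Sum>n<S. \<theta> ^ n) \<le> 17 * real S" by simp
  show ?thesis
  proof (cases "\<rho> = 1")
    case False
    define y where "y = (1 - \<rho>) / 16"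
    have y: "y > 0" using rho False by (simp add: y_def)
    have "(1 - \<rho>) / 4 \<le> (1 - \<rho>) / (1 + 3 * \<rho>)" using rho by (intro divide_left_mono) auto
    then have "\<theta> \<le> (3 / 4) powr ((1 - \<rho>) / 4)" unfolding \<theta>_def by (intro powr_mono') auto
    also have "\<dots> = exp ((1 - \<rho>) / 4 * ln (3 / 4))" by (simp add: powr_def)
    also have "\<dots> \<le> exp (- y)"
    proof -
      have "ln (3 / 4 :: real) \<le> 3 / 4 - 1" by (rule ln_le_minus_one) simp
      then have "(1 - \<rho>) / 4 * ln (3 / 4) \<le> (1 - \<rho>) / 4 * (- 1 / 4)"
        using rho by (intro mult_left_mono) auto
      then show ?thesis by (simp add: y_def)
    qed
    also have "\<dots> \<le> 1 / (1 + y)"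
      using exp_ge_add_one_self[of y] y by (simp add: exp_minus divide_inverse)
    finally have \<theta>: "\<theta> \<le> 1 / (1 + y)" .
    then have less: "y / (1 + y) \<le> 1 - \<theta>" using y by (simp add: field_simps)
    have "y / (1 + y) > 0" using y by simp
    then have lt1: "1 - \<theta> > 0" using less by linarith
    have "(\<Sum>n<S. \<theta> ^ n) = (1 - \<theta> ^ S) / (1 - \<theta>)" using lt1 by (simp add: sum_gp_strict)
    also have "\<dots> \<le> 1 / (1 - \<theta>)" using lt1 pos by (intro divide_right_mono) auto
    also have "\<dots> \<le> 1 / (y / (1 + y))" using less y lt1 by (intro divide_left_mono) auto
    also have "\<dots> = 1 + 16 / (1 - \<rho>)" using y False by (simp add: y_def field_simps)
    also have "\<dots> \<le> 17 * (1 / (1 - \<rho>))"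
    proof -
      have "1 \<le> 1 / (1 - \<rho>)" using rho False by simp
      then show ?thesis by simp
    qed
    finally show ?thesis using le_S False by (simp add: min_def)
  qed (use le_S in simp)
qed

context blw_problem
begin

text \<open>
  \<open>outer_work P\<close> is a constant times \<open>P powr (- (1 - \<rho>) / (1 + 3 * \<rho>))\<close>, so every factor \<open>4/3\<close>
  in \<open>P\<close> gains one factor \<open>(3/4) powr ((1 - \<rho>) / (1 + 3 * \<rho>))\<close>.
  The constants \<open>64 * 16/3\<close> coming from \<open>4 * P / \<mu>s\<close>, \<open>2 / P\<close> and
  \<open>3/16\<close> are bounded by \<open>400\<close>.
\<close>

lemma outer_work_le:
  assumes eps: "\<epsilon> > 0" and P: "3 / 16 * (\<mu>s * \<epsilon>) * (4 / 3) ^ n \<le> P"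
  shows "outer_work P \<le> 400 * (M\<^sup>2 / (\<mu>s powr (1 + \<rho>) * \<epsilon> powr (1 - \<rho>))) powr (1 / (1 + 3 * \<rho>)) *
    ((3 / 4) powr ((1 - \<rho>) / (1 + 3 * \<rho>))) ^ n"
proof -
  define e where "e = 1 / (1 + 3 * \<rho>)"
  have e: "0 \<le> e" "e \<le> 1" using rho by (auto simp: e_def)
  define R where "R = (4 / 3 :: real) ^ n"
  have R: "R > 0" by (simp add: R_def)
  have low: "0 < 3 / 16 * (\<mu>s * \<epsilon>) * R" using R eps mus by simp
  then have Ppos: "P > 0" using P unfolding R_def by linarith
  have "(4 * P / \<mu>s) powr (2 * \<rho>) * (2 / P) powr (1 + \<rho>)
      = 4 powr (2 * \<rho>) * 2 powr (1 + \<rho>) * \<mu>s powr (- (2 * \<rho>)) * P powr (- (1 - \<rho>))"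
  proof -
    have "P powr (2 * \<rho>) = P powr (1 + \<rho>) * P powr (- (1 - \<rho>))" by (simp flip: powr_add)
    then show ?thesis using Ppos mus by (simp add: powr_mult powr_divide powr_minus field_simps)
  qed
  also have "\<dots> \<le> 4 powr 2 * 2 powr 2 * \<mu>s powr (- (2 * \<rho>)) * (3 / 16 * (\<mu>s * \<epsilon>) * R) powr (- (1 - \<rho>))"
  proof (rule mult_mono[OF mult_right_mono])
    show "4 powr (2 * \<rho>) * 2 powr (1 + \<rho>) \<le> (4 powr 2 * 2 powr 2 :: real)"
      using rho by (intro mult_mono powr_mono) auto
    show "P powr (- (1 - \<rho>)) \<le> (3 / 16 * (\<mu>s * \<epsilon>) * R) powr (- (1 - \<rho>))"
      using rho low P by (intro powr_mono2') (auto simp: R_def)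
  qed auto
  also have "(3 / 16 * (\<mu>s * \<epsilon>) * R) powr (- (1 - \<rho>)) =
      (16 / 3) powr (1 - \<rho>) * (\<mu>s powr (- (1 - \<rho>)) * \<epsilon> powr (- (1 - \<rho>)) * R powr (- (1 - \<rho>)))"
  proof -
    have "(3 / 16 :: real) powr (- (1 - \<rho>)) = (16 / 3) powr (1 - \<rho>)"
      by (simp only: powr_minus powr_divide) (simp add: powr_divide)
    then show ?thesis using mus eps R by (simp only: powr_mult mult.assoc)
  qed
  also have "4 powr 2 * 2 powr 2 * \<mu>s powr (- (2 * \<rho>)) * \<dots> =
      (64 * (16 / 3) powr (1 - \<rho>)) *
      ((\<mu>s powr (- (2 * \<rho>)) * \<mu>s powr (- (1 - \<rho>))) * \<epsilon> powr (- (1 - \<rho>)) * R powr (- (1 - \<rho>)))"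
    by simp
  also have "\<mu>s powr (- (2 * \<rho>)) * \<mu>s powr (- (1 - \<rho>)) = \<mu>s powr (- (1 + \<rho>))"
  proof -
    have "- (2 * \<rho>) + - (1 - \<rho>) = - (1 + \<rho>)" by simp
    then show ?thesis by (simp only: powr_add[symmetric])
  qed
  also have "64 * (16 / 3) powr (1 - \<rho>) * (\<mu>s powr (- (1 + \<rho>)) * \<epsilon> powr (- (1 - \<rho>)) * R powr (- (1 - \<rho>)))
      \<le> 400 * (\<mu>s powr (- (1 + \<rho>)) * \<epsilon> powr (- (1 - \<rho>)) * R powr (- (1 - \<rho>)))"
  proof (rule mult_right_mono)
    have "(16 / 3 :: real) powr (1 - \<rho>) \<le> (16 / 3) powr 1" using rho by (intro powr_mono) auto
    then show "64 * (16 / 3) powr (1 - \<rho>) \<le> 400" by simp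
  qed simp
  finally have "M\<^sup>2 * ((4 * P / \<mu>s) powr (2 * \<rho>) * (2 / P) powr (1 + \<rho>)) \<le>
      M\<^sup>2 * (400 * (\<mu>s powr (- (1 + \<rho>)) * \<epsilon> powr (- (1 - \<rho>)) * R powr (- (1 - \<rho>))))"
    by (rule mult_left_mono) simp
  also have "\<dots> = 400 * (M\<^sup>2 / (\<mu>s powr (1 + \<rho>) * \<epsilon> powr (1 - \<rho>)) * R powr (- (1 - \<rho>)))"
    by (simp only: powr_minus divide_inverse inverse_mult_distrib mult_ac)
  finally have "outer_work P \<le>
      (400 * (M\<^sup>2 / (\<mu>s powr (1 + \<rho>) * \<epsilon> powr (1 - \<rho>)) * R powr (- (1 - \<rho>)))) powr e"
    unfolding outer_work_def work_def e_def[symmetric] mult.assoc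
    using e by (intro powr_mono2) auto
  also have "\<dots> = 400 powr e * (M\<^sup>2 / (\<mu>s powr (1 + \<rho>) * \<epsilon> powr (1 - \<rho>))) powr e * R powr (- (1 - \<rho>) * e)"
    by (simp only: powr_mult powr_powr mult.assoc)
  also have "R powr (- (1 - \<rho>) * e) = ((3 / 4) powr ((1 - \<rho>) * e)) ^ n"
  proof -
    have "R powr (- (1 - \<rho>) * e) = inverse R powr ((1 - \<rho>) * e)"
      unfolding minus_mult_left[symmetric] powr_minus using R by (simp only: inverse_powr less_imp_le)
    also have "inverse R = (3 / 4) powr real n"
      by (simp add: R_def powr_realpow power_inverse[symmetric])
    also have "\<dots> powr ((1 - \<rho>) * e) = ((3 / 4) powr ((1 - \<rho>) * e)) powr real n"
      by (simp add: powr_powr mult.commute)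
    also have "\<dots> = ((3 / 4) powr ((1 - \<rho>) * e)) ^ n" by (rule powr_realpow) simp
    finally show ?thesis .
  qed
  also have "400 powr e * (M\<^sup>2 / (\<mu>s powr (1 + \<rho>) * \<epsilon> powr (1 - \<rho>))) powr e * \<dots> \<le>
      400 powr 1 * (M\<^sup>2 / (\<mu>s powr (1 + \<rho>) * \<epsilon> powr (1 - \<rho>))) powr e * ((3 / 4) powr ((1 - \<rho>) * e)) ^ n"
    using e by (intro mult_right_mono powr_mono) auto
  finally show ?thesis by (simp add: e_def)
qed

text \<open>
  Iterating \<open>outer_iteration\<close> shows that all outer iterations complete. The logarithms
  \<open>log 2 (\<mu>\<^sub>k / \<mu>\<^sub>k\<^sub>+\<^sub>1)\<close> telescope, so all halvings together are counted once.
\<close>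

lemma outer_sequence:
  assumes start: "\<sigma> 0 = Completed 0 xbar0 \<mu>0 \<Delta>0" and inv0: "outer_inv P xbar0 \<mu>0 \<Delta>0" and P: "P > 0"
  shows "\<exists>\<tau> c \<mu> \<Delta>. \<Delta> 0 = \<Delta>0 \<and>
    (\<forall>k. \<sigma> (\<tau> k) = Completed k (c k) (\<mu> k) (\<Delta> k)) \<and>
    (\<forall>k. outer_inv ((3 / 4) ^ k * P) (c k) (\<mu> k) (\<Delta> k)) \<and>
    (\<forall>k. infdist (c (Suc k)) Xs \<le> infdist (c k) Xs) \<and>
    (\<forall>k. real (\<Sum>i<\<tau> k. q i) \<le> 6 * real k + 2 * log 2 (\<mu>0 / \<mu> k) +
      35200 * (\<Sum>j=1..k. outer_work ((3 / 4) ^ j * P)))"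
proof -
  define good where "good k s \<longleftrightarrow> (case s of (n, x, u, v) \<Rightarrow> \<sigma> n = Completed k x u v \<and>
    outer_inv ((3 / 4) ^ k * P) x u v \<and> (k = 0 \<longrightarrow> v = \<Delta>0) \<and>
    real (\<Sum>i<n. q i) \<le> 6 * real k + 2 * log 2 (\<mu>0 / u) +
      35200 * (\<Sum>j=1..k. outer_work ((3 / 4) ^ j * P)))" for k and s :: "nat \<times> 'a \<times> real \<times> real"
  have mu0: "\<mu>0 > 0" using inv0 mus by (auto simp: outer_inv_def)
  have "\<exists>F. \<forall>k. good k (F k) \<and> infdist (fst (snd (F (Suc k)))) Xs \<le> infdist (fst (snd (F k))) Xs"
  proof (rule dependent_nat_choice)
    show "\<exists>s. good 0 s"
      using start inv0 mu0 by (intro exI[of _ "(0, xbar0, \<mu>0, \<Delta>0)"]) (simp add: good_def)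
    fix s k assume "good k s"
    moreover obtain n x u v where s: "s = (n, x, u, v)" by (cases s) auto
    ultimately have st: "\<sigma> n = Completed k x u v" "outer_inv ((3 / 4) ^ k * P) x u v"
      and cost: "real (\<Sum>i<n. q i) \<le> 6 * real k + 2 * log 2 (\<mu>0 / u) +
        35200 * (\<Sum>j=1..k. outer_work ((3 / 4) ^ j * P))"
      by (auto simp: good_def)
    have Pk: "(3 / 4) ^ k * P > 0" using P by simp
    obtain n' x' u' v' where nx: "\<sigma> n' = Completed (Suc k) x' u' v'" "n < n'"
        "outer_inv (3 / 4 * ((3 / 4) ^ k * P)) x' u' v'" "infdist x' Xs \<le> infdist x Xs"
      and cost': "real (\<Sum>i=n..<n'. q i) \<le> 6 + 2 * log 2 (u / u') +
        35200 * outer_work (3 / 4 * ((3 / 4) ^ k * P))"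
      using outer_iteration[OF st Pk] by blast
    have u: "u > 0" "u' > 0" using st(2) nx(3) mus by (auto simp: outer_inv_def)
    have "log 2 (\<mu>0 / u') = log 2 (\<mu>0 / u) + log 2 (u / u')"
      using u mu0 by (simp add: log_divide)
    moreover have "(\<Sum>i<n'. q i) = (\<Sum>i<n. q i) + (\<Sum>i=n..<n'. q i)"
      using nx(2) by (simp add: lessThan_atLeast0 sum.atLeastLessThan_concat)
    ultimately have "real (\<Sum>i<n'. q i) \<le> 6 * real (Suc k) + 2 * log 2 (\<mu>0 / u') +
        35200 * (\<Sum>j=1..Suc k. outer_work ((3 / 4) ^ j * P))"
      using cost cost' by (simp add: distrib_left mult.assoc)
    then have "good (Suc k) (n', x', u', v')"
      using nx by (simp add: good_def mult.assoc)
    then show "\<exists>s'. good (Suc k) s' \<and> infdist (fst (snd s')) Xs \<le> infdist (fst (snd s)) Xs"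
      using nx(4) s by (intro exI[of _ "(n', x', u', v')"]) simp
  qed
  then obtain F where F: "\<And>k. good k (F k)"
    "\<And>k. infdist (fst (snd (F (Suc k)))) Xs \<le> infdist (fst (snd (F k))) Xs" by blast
  show ?thesis
    using F F(1)[of 0]
    by (intro exI[of _ "\<lambda>k. fst (F k)"] exI[of _ "\<lambda>k. fst (snd (F k))"]
        exI[of _ "\<lambda>k. fst (snd (snd (F k)))"] exI[of _ "\<lambda>k. snd (snd (snd (F k)))"])
      (auto simp: good_def case_prod_beta)
qed

lemma outer_inv_gap:
  assumes "outer_inv P c \<mu> \<Delta>"
  shows "f c - fs \<le> 4 * P / \<mu>s"
proof -
  have \<mu>: "\<mu> > 0" "\<mu>s / 4 \<le> \<mu>" and eq: "\<mu> * \<Delta> = P"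
    and gap: "f c - fs \<le> \<Delta> \<or> f c - fs \<le> P / \<mu>s" and c: "c \<in> X"
    using assms mus by (auto simp: outer_inv_def)
  have "f c - fs \<ge> 0" using fs_le c by simp
  from gap show ?thesis
  proof
    assume le: "f c - fs \<le> \<Delta>"
    then have "\<Delta> \<ge> 0" using \<open>f c - fs \<ge> 0\<close> by linarith
    then have "\<mu>s / 4 * \<Delta> \<le> P" unfolding eq[symmetric] using \<mu> by (intro mult_right_mono)
    then have "\<Delta> \<le> 4 * P / \<mu>s" using mus by (simp add: field_simps)
    with le show ?thesis by linarith
  next
    assume le: "f c - fs \<le> P / \<mu>s"
    then have "P / \<mu>s \<ge> 0" using \<open>f c - fs \<ge> 0\<close> by linarith
    with le show ?thesis by simp
  qed
qed

text \<open>
  If \<open>S > 0\<close>, then by the choice of \<open>S\<close> as a ceiling \<open>(3/4) ^ S * P\<close> is still at least \<open>3/16 * (\<mu>s * \<epsilon>)\<close>. Read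
  backwards from the last outer iteration, the costs decay at least geometrically.
\<close>

lemma total_work_le:
  assumes eps: "\<epsilon> > 0" and P: "P > 0"
    and S: "S = nat (max 0 \<lceil>log (4 / 3) (4 * P / (\<mu>s * \<epsilon>))\<rceil>)"
  shows "(\<Sum>j=1..S. outer_work ((3 / 4) ^ j * P)) \<le>
    6800 * (if \<rho> = 1 then real S else min (1 / (1 - \<rho>)) (real S)) *
    (M\<^sup>2 / (\<mu>s powr (1 + \<rho>) * \<epsilon> powr (1 - \<rho>))) powr (1 / (1 + 3 * \<rho>))"
proof -
  define T where "T = (M\<^sup>2 / (\<mu>s powr (1 + \<rho>) * \<epsilon> powr (1 - \<rho>))) powr (1 / (1 + 3 * \<rho>))"
  define \<theta> where "\<theta> = (3 / 4 :: real) powr ((1 - \<rho>) / (1 + 3 * \<rho>))"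
  have summand: "outer_work ((3 / 4) ^ j * P) \<le> 400 * T * \<theta> ^ (S - j)" if j: "j \<in> {1..S}" for j
    unfolding T_def \<theta>_def
  proof (rule outer_work_le[OF eps])
    have "real S - 1 < log (4 / 3) (4 * P / (\<mu>s * \<epsilon>))" using S j by (auto simp: max_def split: if_splits) linarith
    then have "(4 / 3) powr (real S - 1) < 4 * P / (\<mu>s * \<epsilon>)"
      using P eps mus by (subst (asm) less_log_iff) auto
    also have "(4 / 3 :: real) powr (real S - 1) = 3 / 4 * (4 / 3) ^ S"
      by (simp add: powr_diff powr_realpow)
    finally have "3 / 16 * (\<mu>s * \<epsilon>) * (4 / 3) ^ S \<le> P" using eps mus by (simp add: field_simps)
    then have "(3 / 4) ^ j * (3 / 16 * (\<mu>s * \<epsilon>) * (4 / 3) ^ S) \<le> (3 / 4) ^ j * P"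
      by (rule mult_left_mono) simp
    also have "(3 / 4) ^ j * (3 / 16 * (\<mu>s * \<epsilon>) * (4 / 3) ^ S) = 3 / 16 * (\<mu>s * \<epsilon>) * (4 / 3) ^ (S - j)"
    proof -
      have "(4 / 3 :: real) ^ S = (4 / 3) ^ j * (4 / 3) ^ (S - j)"
        using j by (simp flip: power_add)
      moreover have "(3 / 4 :: real) ^ j * (4 / 3) ^ j = 1" by (simp flip: power_mult_distrib)
      ultimately show ?thesis by simp
    qed
    finally show "3 / 16 * (\<mu>s * \<epsilon>) * (4 / 3) ^ (S - j) \<le> (3 / 4) ^ j * P" .
  qed
  have "(\<Sum>j=1..S. outer_work ((3 / 4) ^ j * P)) \<le> (\<Sum>j=1..S. 400 * T * \<theta> ^ (S - j))"
    by (intro sum_mono summand)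
  also have "\<dots> = 400 * T * (\<Sum>n<S. \<theta> ^ n)"
    unfolding sum_distrib_left[symmetric]
    by (intro arg_cong2[of _ _ _ _ "(*)"] refl
        sum.reindex_bij_witness[of _ "\<lambda>n. S - n" "\<lambda>j. S - j"]) auto
  also have "\<dots> \<le> 400 * T * (17 * (if \<rho> = 1 then real S else min (1 / (1 - \<rho>)) (real S)))"
    unfolding \<theta>_def by (intro mult_left_mono geometric_sum_le rho) (simp add: T_def)
  also have "\<dots> = 6800 * (if \<rho> = 1 then real S else min (1 / (1 - \<rho>)) (real S)) * T"
    by simp
  finally show ?thesis unfolding T_def .
qed

end

theorem theorem4p5:
  "\<exists>C::real. \<forall>(d::nat) (X::fsvec set) (f::fsvec \<Rightarrow> real) (D::fsvec \<Rightarrow> fsvec set) (g::fsvec \<Rightarrow> fsvec)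
      (xbar0::fsvec) (\<mu>s::real) (\<rho>::real) (M::real) (m::nat) (\<mu>0::real)
      (\<sigma>::nat \<Rightarrow> fsvec blw_state) (q::nat \<Rightarrow> nat) (Xs::fsvec set) (fs::real).
    X \<subseteq> Rn d \<and> closed X \<and> convex X \<and>
    convex_on X f \<and> closed (epigraph X f) \<and>
    Xs = argmin_set X f \<and> Xs \<noteq> {} \<and> fs = (INF x\<in>X. f x) \<and>
    (\<forall>y\<in>X. D y \<subseteq> subdifferential d X f y) \<and> (\<forall>y\<in>X. g y \<in> D y) \<and>
    xbar0 \<in> X \<and> g xbar0 \<noteq> 0 \<and>
    \<mu>s > 0 \<and> (\<forall>x\<in>{z\<in>X. f z \<le> f xbar0}. f x - fs \<ge> \<mu>s / 2 * (infdist x Xs)\<^sup>2) \<and>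
    0 \<le> \<rho> \<and> \<rho> \<le> 1 \<and> M > 0 \<and> holder_smooth_on X f D \<rho> M \<and>
    m \<ge> 1 \<and> \<mu>0 \<ge> \<mu>s \<and>
    blw_run X f g xbar0 \<mu>0 m \<sigma> q
    \<longrightarrow>
    (\<exists>(\<tau>::nat \<Rightarrow> nat) (xbar::nat \<Rightarrow> fsvec) (\<mu>::nat \<Rightarrow> real) (\<Delta>::nat \<Rightarrow> real).
      (\<forall>k. \<sigma> (\<tau> k) = Completed k (xbar k) (\<mu> k) (\<Delta> k)) \<and>
      (\<forall>k\<ge>1. infdist (xbar k) Xs \<le> infdist (xbar (k - 1)) Xs) \<and>
      (\<forall>\<epsilon>>0. \<forall>S N.
        S = nat (max 0 \<lceil>log (4 / 3) (4 * \<mu>0 * \<Delta> 0 / (\<mu>s * \<epsilon>))\<rceil>) \<and>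
        N = queries_until q (\<tau> S)
        \<longrightarrow>
        int S \<le> max 0 \<lceil>log (4 / 3) (8 * (norm (g xbar0))\<^sup>2 / (\<mu>s * \<epsilon>))\<rceil> \<and>
        f (xbar S) - fs \<le> \<epsilon> \<and>
        real N \<le> C * (if \<rho> = 1 then real S else min (1 / (1 - \<rho>)) (real S))
                    * (M\<^sup>2 / (\<mu>s powr (1 + \<rho>) * \<epsilon> powr (1 - \<rho>))) powr (1 / (1 + 3 * \<rho>))
                  + 10 * real S + 2 * log 2 (4 * \<mu>0 / \<mu>s) + 1))"
proof (rule exI[of _ "35200 * 6800"], intro allI impI, elim conjE)
  fix d :: nat and X :: "fsvec set" and f :: "fsvec \<Rightarrow> real" and D :: "fsvec \<Rightarrow> fsvec set"
    and g :: "fsvec \<Rightarrow> fsvec" and xbar0 :: fsvec and \<mu>s \<rho> M :: real and m :: nat and \<mu>0 :: real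
    and \<sigma> :: "nat \<Rightarrow> fsvec blw_state" and q :: "nat \<Rightarrow> nat" and Xs :: "fsvec set" and fs :: real
  assume convex: "convex X" "convex_on X f"
    and Xs: "Xs = argmin_set X f" "Xs \<noteq> {}" and fs: "fs = (INF x\<in>X. f x)"
    and D: "\<forall>y\<in>X. D y \<subseteq> subdifferential d X f y" and g: "\<forall>y\<in>X. g y \<in> D y"
    and x0: "xbar0 \<in> X" "g xbar0 \<noteq> 0" and mus: "\<mu>s > 0"
    and growth: "\<forall>x\<in>{z\<in>X. f z \<le> f xbar0}. f x - fs \<ge> \<mu>s / 2 * (infdist x Xs)\<^sup>2"
    and rho: "0 \<le> \<rho>" "\<rho> \<le> 1" and M: "M > 0" and holder: "holder_smooth_on X f D \<rho> M"
    and m: "m \<ge> 1" and mu0: "\<mu>0 \<ge> \<mu>s" and steps: "blw_run X f g xbar0 \<mu>0 m \<sigma> q"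
  obtain p where p: "p \<in> X" "\<And>x. x \<in> X \<Longrightarrow> f p \<le> f x" using Xs by (auto simp: argmin_set_def)
  have "bdd_below (f ` X)" using p(2) by (auto intro!: bdd_belowI2[of _ "f p"])
  then have fs_le: "fs \<le> f x" if "x \<in> X" for x unfolding fs using that by (rule cINF_lower)
  have fs_eq: "f x = fs" if "x \<in> Xs" for x
  proof (rule antisym)
    show "f x \<le> fs" unfolding fs using that Xs p(1) by (intro cINF_greatest) (auto simp: argmin_set_def)
    show "fs \<le> f x" using that Xs by (intro fs_le) (auto simp: argmin_set_def)
  qed
  \<comment> \<open>All estimates hold in any real inner product space, which makes the constant independent
    of \<open>d\<close>.\<close>
  interpret blw_problem X f g \<rho> M m xbar0 \<mu>s fs Xs \<sigma> q
  proof
    show "f y + inner (g y) (x - y) \<le> f x" if "y \<in> X" "x \<in> X" for x y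
      using D g that unfolding subdifferential_def by blast
    show "f y \<le> f x + inner (g x) (y - x) + M / (1 + \<rho>) * norm (y - x) powr (1 + \<rho>)"
      if "x \<in> X" "y \<in> X" for x y
      using holder g that unfolding holder_smooth_on_def by blast
    show "Xs \<subseteq> X" using Xs by (auto simp: argmin_set_def)
    show "blw_step X f g m (\<sigma> n) (q n) (\<sigma> (Suc n))" for n using steps by (simp add: blw_run_def)
  qed (use convex Xs x0 mus growth rho M m fs_le fs_eq in auto)
  define \<Delta>0 where "\<Delta>0 = 2 * (norm (g xbar0))\<^sup>2 / \<mu>0"
  define P where "P = \<mu>0 * \<Delta>0"
  have mu0_pos: "\<mu>0 > 0" using mu0 mus by linarith
  have P_eq: "P = 2 * (norm (g xbar0))\<^sup>2" using mu0_pos by (simp add: P_def \<Delta>0_def)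
  have P: "P > 0" using x0 by (simp add: P_eq)
  have start: "\<sigma> 0 = Completed 0 xbar0 \<mu>0 \<Delta>0" using steps by (simp add: blw_run_def \<Delta>0_def)
  have inv0: "outer_inv P xbar0 \<mu>0 \<Delta>0"
    using initial_gap x0 mu0 mus by (simp add: outer_inv_def P_def[symmetric]) (simp add: P_eq)
  obtain \<tau> c \<mu> \<Delta> where init: "\<Delta> 0 = \<Delta>0"
    and seq: "\<forall>k. \<sigma> (\<tau> k) = Completed k (c k) (\<mu> k) (\<Delta> k)"
    and inv_all: "\<forall>k. outer_inv ((3 / 4) ^ k * P) (c k) (\<mu> k) (\<Delta> k)"
    and fejer: "\<forall>k. infdist (c (Suc k)) Xs \<le> infdist (c k) Xs"
    and cost: "\<forall>k. real (\<Sum>i<\<tau> k. q i) \<le> 6 * real k + 2 * log 2 (\<mu>0 / \<mu> k) +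
      35200 * (\<Sum>j=1..k. outer_work ((3 / 4) ^ j * P))"
    using outer_sequence[OF start inv0 P] by (elim exE conjE)
  note inv = inv_all[rule_format]
  let ?T = "\<lambda>\<epsilon>. (M\<^sup>2 / (\<mu>s powr (1 + \<rho>) * \<epsilon> powr (1 - \<rho>))) powr (1 / (1 + 3 * \<rho>))"
  let ?min = "\<lambda>S. if \<rho> = 1 then real S else min (1 / (1 - \<rho>)) (real S)"
  have bounds: "int S \<le> max 0 \<lceil>log (4 / 3) (8 * (norm (g xbar0))\<^sup>2 / (\<mu>s * \<epsilon>))\<rceil> \<and>
      f (c S) - fs \<le> \<epsilon> \<and>
      real N \<le> 35200 * 6800 * ?min S * ?T \<epsilon> + 10 * real S + 2 * log 2 (4 * \<mu>0 / \<mu>s) + 1"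
    if eps: "\<epsilon> > 0" and S0: "S = nat (max 0 \<lceil>log (4 / 3) (4 * \<mu>0 * \<Delta> 0 / (\<mu>s * \<epsilon>))\<rceil>)"
      and N: "N = queries_until q (\<tau> S)" for \<epsilon> S N
  proof (intro conjI)
    have eq: "4 * \<mu>0 * \<Delta> 0 = 4 * P" by (simp add: init P_def)
    note S = S0[unfolded eq]
    show "int S \<le> max 0 \<lceil>log (4 / 3) (8 * (norm (g xbar0))\<^sup>2 / (\<mu>s * \<epsilon>))\<rceil>"
      by (simp add: S P_eq)
    have "log (4 / 3) (4 * P / (\<mu>s * \<epsilon>)) \<le> real S" unfolding S by linarith
    then have "4 * P / (\<mu>s * \<epsilon>) \<le> (4 / 3) powr real S"
      using P eps mus by (subst (asm) log_le_iff) auto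
    then have "4 * P / \<mu>s * (3 / 4) ^ S \<le> \<epsilon> * (4 / 3) ^ S * (3 / 4) ^ S"
      using eps mus by (intro mult_right_mono) (simp_all add: powr_realpow field_simps)
    also have "\<dots> = \<epsilon>" by (simp add: mult.assoc flip: power_mult_distrib)
    finally show "f (c S) - fs \<le> \<epsilon>" using outer_inv_gap[OF inv[of S]] by (simp add: mult_ac)
    have "\<mu> S > 0" "\<mu>s / 4 \<le> \<mu> S" using inv[of S] mus by (auto simp: outer_inv_def)
    then have "\<mu>0 / \<mu> S \<le> \<mu>0 / (\<mu>s / 4)" using mu0_pos mus by (intro divide_left_mono) auto
    then have "log 2 (\<mu>0 / \<mu> S) \<le> log 2 (4 * \<mu>0 / \<mu>s)"
      using mu0_pos mus \<open>\<mu> S > 0\<close> by (subst log_le_cancel_iff) (auto simp: mult.commute)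
    moreover have "35200 * (\<Sum>j=1..S. outer_work ((3 / 4) ^ j * P)) \<le> 35200 * 6800 * ?min S * ?T \<epsilon>"
      using total_work_le[OF eps P S] by linarith
    moreover have "real N = 1 + real (\<Sum>i<\<tau> S. q i)" by (simp add: N queries_until_def)
    ultimately show "real N \<le> 35200 * 6800 * ?min S * ?T \<epsilon> + 10 * real S + 2 * log 2 (4 * \<mu>0 / \<mu>s) + 1"
      using cost[rule_format, of S] by linarith
  qed
  have fejer': "infdist (c k) Xs \<le> infdist (c (k - 1)) Xs" if "k \<ge> 1" for k
    using fejer[rule_format, of "k - 1"] that by simp
  show "\<exists>\<tau> xbar \<mu> \<Delta>.
      (\<forall>k. \<sigma> (\<tau> k) = Completed k (xbar k) (\<mu> k) (\<Delta> k)) \<and>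
      (\<forall>k\<ge>1. infdist (xbar k) Xs \<le> infdist (xbar (k - 1)) Xs) \<and>
      (\<forall>\<epsilon>>0. \<forall>S N.
        S = nat (max 0 \<lceil>log (4 / 3) (4 * \<mu>0 * \<Delta> 0 / (\<mu>s * \<epsilon>))\<rceil>) \<and> N = queries_until q (\<tau> S) \<longrightarrow>
        int S \<le> max 0 \<lceil>log (4 / 3) (8 * (norm (g xbar0))\<^sup>2 / (\<mu>s * \<epsilon>))\<rceil> \<and>
        f (xbar S) - fs \<le> \<epsilon> \<and>
        real N \<le> 35200 * 6800 * (if \<rho> = 1 then real S else min (1 / (1 - \<rho>)) (real S))
                    * (M\<^sup>2 / (\<mu>s powr (1 + \<rho>) * \<epsilon> powr (1 - \<rho>))) powr (1 / (1 + 3 * \<rho>))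
                  + 10 * real S + 2 * log 2 (4 * \<mu>0 / \<mu>s) + 1)"
    using seq fejer' bounds by blast
qed

end
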